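(* Let $m$ be a positive even integer, $n$ a positive integer, and let $u_0,u_1,\dots,u_{(n-1)m}$ be pairwise distinct real numbers. Let $U\in\mathbb{R}^{[(n-1)m+1]\times[(n-1)m+1]}$ be the Vandermonde matrix whose $k$th column is $(1,u_k,\dots,u_k^{(n-1)m})^\top$, $k=0,\dots,(n-1)m$. Then $$HSOS(m,n)^*=\{(U^\top)^{-1}\boldsymbol{\alpha}:\boldsymbol{\alpha}\in SG^*\},$$ where $SG^*$, the dual cone of $SG$, is given by $$SG^*=\operatorname{cl}\Big\{(\mathcal{A}\mathbf{u}_0^m,\mathcal{A}\mathbf{u}_1^m,\dots,\mathcal{A}\mathbf{u}_{(n-1)m}^m)^\top\in\mathbb{R}^{(n-1)m+1}:\ \mathcal{A}\in SOS_{m,n}^*\Big\}$$ with $\mathbf{u}_k=(1,u_k,\dots,u_k^{n-1})^\top\in\mathbb{R}^n$.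
   Context: For $\mathbf{x}=(x_0,\dots,x_p)^\top$ and $\mathbf{y}=(y_0,\dots,y_q)^\top$ real vectors, the convolution $\mathbf{x}*\mathbf{y}\in\mathbb{R}^{p+q+1}$ has entries $(\mathbf{x}*\mathbf{y})_i=\sum_{i_1+i_2=i,\,0\le i_1\le p,\,0\le i_2\le q}x_{i_1}y_{i_2}$. For $\mathbf{x}\in\mathbb{R}^n$, $\mathbf{x}^{*m}=\mathbf{x}*\cdots*\mathbf{x}$ ($m$ factors) $\in\mathbb{R}^{(n-1)m+1}$; $\bullet$ is the standard inner product. $HSOS(m,n)$ is the set of $\mathbf{v}\in\mathbb{R}^{(n-1)m+1}$ such that the homogeneous polynomial $\mathbf{v}\bullet\mathbf{x}^{*m}$ in $\mathbf{x}\in\mathbb{R}^n$ is a finite sum of squares of real homogeneous polynomials of degree $m/2$. $S_{m,n}$ is the space of real symmetric tensors $\mathcal{A}=(a_{i_1\cdots i_m})$ of order $m$ and dimension $n$, with inner product $\langle\mathcal{A},\mathcal{B}\rangle=\sum a_{i_1\cdots i_m}b_{i_1\cdots i_m}$; $\mathcal{A}\mathbf{x}^m=\sum a_{i_1\cdots i_m}x_{i_1}\cdots x_{i_m}$ for $\mathbf{x}\in\mathbb{R}^n$; $\mathbf{u}^{\otimes m}\in S_{m,n}$ is the rank-one tensor with entries $u_{i_1}\cdots u_{i_m}$, where $u_i$ here denotes the components of $\mathbf{u}$. $SOS_{m,n}$ is the set of $\mathcal{A}\in S_{m,n}$ such that $\mathcal{A}\mathbf{x}^m$ is a sum of squares of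 real polynomials in $\mathbf{x}$. Define $SG=\{\boldsymbol{\alpha}\in\mathbb{R}^{(n-1)m+1}:\sum_{k=0}^{(n-1)m}\alpha_k\mathbf{u}_k^{\otimes m}\in SOS_{m,n}\}$. For a subset $S$ of a Euclidean space (with its inner product $\langle\cdot,\cdot\rangle$; the standard inner product on $\mathbb{R}^N$, and the inner product $\langle\mathcal{A},\mathcal{B}\rangle=\sum a_{i_1\cdots i_m}b_{i_1\cdots i_m}$ on $S_{m,n}$), the dual cone is $S^*=\{y:\langle y,x\rangle\ge 0\text{ for all }x\in S\}$. $\operatorname{cl}$ denotes topological closure. *)

theory Defs
  imports
    "HOL-Analysis.Analysis"
    "HOL-Library.Multiset"
    "Jordan_Normal_Form.Matrix"
    "Jordan_Normal_Form.Gauss_Jordan_Elimination"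
begin

unbundle no vec_syntax
no_notation inner (infix "\<bullet>" 70)

text \<open>
  Since the dimensions \<open>n\<close> and \<open>(n - 1) * m + 1\<close> occur together, as do those of all intermediate
  convolution powers, real vectors are dimension-carrying vectors of \<open>Jordan_Normal_Form\<close>:
  \<open>carrier_vec N\<close> is N-dimensional real space, \<open>\<bullet>\<close> its standard inner product, indexed from 0.
\<close>

text \<open>The usual topology on N-dimensional space, carried over from \<open>Euclidean_space N\<close>, whose points
  are the functions on \<open>nat\<close> vanishing from \<open>N\<close> on.\<close>

definition vec_topology :: "nat \<Rightarrow> real Matrix.vec topology" where
  "vec_topology N =
     pullback_topology (carrier_vec N) (\<lambda>v i. if i < N then v $ i else 0) (Euclidean_space N)"

lemma topspace_vec_topology: "topspace (vec_topology N) = carrier_vec N"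
  by (auto simp: vec_topology_def topspace_pullback_topology topspace_Euclidean_space)

definition dual_cone :: "'a set \<Rightarrow> ('a \<Rightarrow> 'a \<Rightarrow> real) \<Rightarrow> 'a set \<Rightarrow> 'a set" where
  "dual_cone V ip S = {y \<in> V. \<forall>x\<in>S. ip y x \<ge> 0}"


text \<open>The dimension \<open>dim_vec x + dim_vec y - 1\<close> is the intended one for nonempty vectors only.\<close>

definition convolution :: "real Matrix.vec \<Rightarrow> real Matrix.vec \<Rightarrow> real Matrix.vec" where
  "convolution x y = Matrix.vec (dim_vec x + dim_vec y - 1)
     (\<lambda>i. \<Sum>(i1, i2) \<in> {(i1, i2). i1 + i2 = i \<and> i1 < dim_vec x \<and> i2 < dim_vec y}. x $ i1 * y $ i2)"

text \<open>The empty convolution product is the one-dimensional vector with entry 1, which is neutral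
  for convolution; see \<open>conv_power_1\<close> below.\<close>

fun conv_power :: "real Matrix.vec \<Rightarrow> nat \<Rightarrow> real Matrix.vec" where
  "conv_power x 0 = Matrix.vec 1 (\<lambda>_. 1)"
| "conv_power x (Suc m) = convolution x (conv_power x m)"

lemma dim_conv_power:
  assumes "dim_vec x > 0"
  shows "dim_vec (conv_power x m) = (dim_vec x - 1) * m + 1"
proof -
  obtain d where "dim_vec x = Suc d"
    using assms by (cases "dim_vec x") auto
  then show ?thesis
    by (induction m) (auto simp: convolution_def)
qed

lemma conv_power_1:
  assumes "dim_vec x > 0"
  shows "conv_power x 1 = x"
proof (rule eq_vecI)
  fix i assume i: "i < dim_vec x"
  then have "{(i1, i2). i1 + i2 = i \<and> i1 < dim_vec x \<and> i2 < (1::nat)} = {(i, 0)}"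
    by auto
  then show "conv_power x 1 $ i = x $ i"
    using i by (simp add: convolution_def)
qed (simp add: convolution_def)


text \<open>Real polynomials in \<open>n\<close> variables, and forms of degree \<open>d\<close>, as functions on n-dimensional
  space; only the values \<open>e i\<close> with \<open>i < n\<close> of an exponent function \<open>e\<close> matter. The zero polynomial
  is a form of every degree.\<close>

definition poly_fun :: "nat \<Rightarrow> (real Matrix.vec \<Rightarrow> real) \<Rightarrow> bool" where
  "poly_fun n f \<longleftrightarrow> (\<exists>(E :: (nat \<Rightarrow> nat) set) c. finite E \<and>
     (\<forall>x \<in> carrier_vec n. f x = (\<Sum>e\<in>E. c e * (\<Prod>i<n. (x $ i) ^ e i))))"

definition homogeneous_poly_fun :: "nat \<Rightarrow> nat \<Rightarrow> (real Matrix.vec \<Rightarrow> real) \<Rightarrow> bool" where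
  "homogeneous_poly_fun n d f \<longleftrightarrow> (\<exists>(E :: (nat \<Rightarrow> nat) set) c. finite E \<and>
     (\<forall>e\<in>E. (\<Sum>i<n. e i) = d) \<and>
     (\<forall>x \<in> carrier_vec n. f x = (\<Sum>e\<in>E. c e * (\<Prod>i<n. (x $ i) ^ e i))))"

definition sum_of_squares_of ::
    "((real Matrix.vec \<Rightarrow> real) \<Rightarrow> bool) \<Rightarrow> nat \<Rightarrow> (real Matrix.vec \<Rightarrow> real) \<Rightarrow> bool" where
  "sum_of_squares_of P n f \<longleftrightarrow> (\<exists>(r::nat) p. (\<forall>j<r. P (p j)) \<and>
     (\<forall>x \<in> carrier_vec n. f x = (\<Sum>j<r. (p j x)\<^sup>2)))"

definition HSOS :: "nat \<Rightarrow> nat \<Rightarrow> real Matrix.vec set" where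
  "HSOS m n = {v \<in> carrier_vec ((n - 1) * m + 1).
     sum_of_squares_of (homogeneous_poly_fun n (m div 2)) n (\<lambda>x. v \<bullet> conv_power x m)}"


text \<open>A tensor of order \<open>m\<close> and dimension \<open>n\<close> is a function on multi-indices, given as lists of
  length \<open>m\<close> with entries below \<open>n\<close>; it is 0 off these lists, so that equality of functions is
  equality of tensors. Lists with the same multiset are exactly the permutations of one another.\<close>

type_synonym tensor = "nat list \<Rightarrow> real"

definition multi_indices :: "nat \<Rightarrow> nat \<Rightarrow> nat list set" where
  "multi_indices m n = {is. length is = m \<and> set is \<subseteq> {..<n}}"

definition symmetric_tensors :: "nat \<Rightarrow> nat \<Rightarrow> tensor set" where
  "symmetric_tensors m n = {A. (\<forall>is. is \<notin> multi_indices m n \<longrightarrow> A is = 0) \<and>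
     (\<forall>is \<in> multi_indices m n. \<forall>js. mset js = mset is \<longrightarrow> A js = A is)}"

definition tensor_inner :: "nat \<Rightarrow> nat \<Rightarrow> tensor \<Rightarrow> tensor \<Rightarrow> real" where
  "tensor_inner m n A B = (\<Sum>is \<in> multi_indices m n. A is * B is)"

definition tensor_form :: "nat \<Rightarrow> nat \<Rightarrow> tensor \<Rightarrow> real Matrix.vec \<Rightarrow> real" where
  "tensor_form m n A x = (\<Sum>is \<in> multi_indices m n. A is * (\<Prod>j<m. x $ (is ! j)))"

definition rank_one_tensor :: "nat \<Rightarrow> nat \<Rightarrow> real Matrix.vec \<Rightarrow> tensor" where
  "rank_one_tensor m n u = (\<lambda>is. if is \<in> multi_indices m n then \<Prod>j<m. u $ (is ! j) else 0)"

definition SOS :: "nat \<Rightarrow> nat \<Rightarrow> tensor set" where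
  "SOS m n = {A \<in> symmetric_tensors m n. sum_of_squares_of (poly_fun n) n (tensor_form m n A)}"


definition vandermonde_vec :: "nat \<Rightarrow> real \<Rightarrow> real Matrix.vec" where
  "vandermonde_vec n t = Matrix.vec n (\<lambda>i. t ^ i)"

definition vandermonde_mat :: "nat \<Rightarrow> (nat \<Rightarrow> real) \<Rightarrow> real Matrix.mat" where
  "vandermonde_mat N u = Matrix.mat N N (\<lambda>(i, k). u k ^ i)"

definition SG :: "nat \<Rightarrow> nat \<Rightarrow> (nat \<Rightarrow> real) \<Rightarrow> real Matrix.vec set" where
  "SG m n u = {\<alpha> \<in> carrier_vec ((n - 1) * m + 1).
     (\<lambda>is. \<Sum>k = 0..(n - 1) * m. \<alpha> $ k * rank_one_tensor m n (vandermonde_vec n (u k)) is)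
       \<in> SOS m n}"

end

theory Submission
  imports Defs "Jordan_Normal_Form.Determinant"
    "HOL-Computational_Algebra.Fundamental_Theorem_Algebra"
begin

text \<open>
  Evaluating the generating function \<open>\<Sum>\<^sub>i x\<^sub>i t ^ i\<close> turns convolution into multiplication, so for
  \<open>v = U \<alpha>\<close> the form \<open>v \<bullet> x\<^sup>*\<^sup>m\<close> equals \<open>\<Sum>\<^sub>k \<alpha>\<^sub>k (u\<^sub>k \<bullet> x) ^ m\<close>, the form of the tensor
  \<open>L \<alpha> = \<Sum>\<^sub>k \<alpha>\<^sub>k u\<^sub>k\<^sup>\<otimes>\<^sup>m\<close>. Hence \<open>HSOS = U ` SG\<close>, because squares summing to a form of degree
  \<open>m\<close> are squares of forms of degree \<open>m / 2\<close>; dualising gives the first equation. For the second,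
  \<open>SG\<close> is the preimage of \<open>SOS\<close> under \<open>L\<close>, the map \<open>A \<mapsto> (A u\<^sub>k\<^sup>m)\<^sub>k\<close> is the adjoint of \<open>L\<close>, and
  \<open>SOS\<close> is a closed convex cone: a point of \<open>SG\<^sup>*\<close> outside the closure of the image of
  \<open>SOS\<^sup>*\<close> would be separated from it by some \<open>\<beta>\<close> with \<open>L \<beta> \<in> SOS\<^sup>*\<^sup>* = SOS\<close>, contradicting
  \<open>\<beta> \<in> SG\<close>.
\<close>

section \<open>Convex cones in finitely many coordinates\<close>

text \<open>Bolzano-Weierstrass, refining the subsequence one coordinate at a time. An arbitrary
  finite index set serves coordinates, multi-indices and pairs of exponents alike.\<close>

lemma finite_family_convergent_subseq:
  fixes g :: "nat \<Rightarrow> 'i \<Rightarrow> real"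
  assumes "finite I" and "\<And>i. i \<in> I \<Longrightarrow> Bseq (\<lambda>k. g k i)"
  obtains r l where "strict_mono (r :: nat \<Rightarrow> nat)" "\<And>i. i \<in> I \<Longrightarrow> (\<lambda>k. g (r k) i) \<longlonglongrightarrow> l i"
proof -
  have "\<exists>r l. strict_mono (r :: nat \<Rightarrow> nat) \<and> (\<forall>i\<in>I. (\<lambda>k. g (r k) i) \<longlonglongrightarrow> l i)"
    using assms
  proof (induction I rule: finite_induct)
    case empty
    show ?case using strict_mono_id by fastforce
  next
    case (insert j I)
    then obtain r l where r: "strict_mono (r :: nat \<Rightarrow> nat)"
      and l: "\<And>i. i \<in> I \<Longrightarrow> (\<lambda>k. g (r k) i) \<longlonglongrightarrow> l i" by blast
    have "Bseq (\<lambda>k. g (r k) j)"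
      using Bseq_subseq[OF insert.prems[of j], of r] by simp
    then have "bounded (range (\<lambda>k. g (r k) j))"
      by (simp add: Bseq_eq_bounded)
    then obtain a s where s: "strict_mono s" and a: "((\<lambda>k. g (r k) j) \<circ> s) \<longlonglongrightarrow> a"
      using bounded_imp_convergent_subsequence by blast
    have "(\<lambda>k. g ((r \<circ> s) k) i) \<longlonglongrightarrow> (l(j := a)) i" if "i \<in> insert j I" for i
    proof (cases "i = j")
      case True
      then show ?thesis using a by (simp add: o_def)
    next
      case False
      with that have "(\<lambda>k. g (r k) i) \<longlonglongrightarrow> l i" using l by blast
      from LIMSEQ_subseq_LIMSEQ[OF this s] show ?thesis using False by (simp add: o_def)
    qed
    moreover have "strict_mono (r \<circ> s)" using r s by (rule strict_mono_o)
    ultimately show ?case by blast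
  qed
  then show ?thesis using that by blast
qed

lemma abs_le_square_plus_one: "\<bar>x\<bar> \<le> x\<^sup>2 + 1" for x :: real
  using zero_le_power2[of "\<bar>x\<bar> - 1"] zero_le_power2[of x] by (simp add: power2_diff)

text \<open>First-order optimality: for small \<open>h\<close> the linear term dominates the
  quadratic one. The restriction \<open>h \<le> 1\<close> lets \<open>1 - h\<close> act as a
  nonnegative scaling factor later.\<close>

lemma linear_part_nonneg:
  fixes a b :: real
  assumes "a \<ge> 0" and *: "\<And>h. 0 < h \<Longrightarrow> h \<le> 1 \<Longrightarrow> 0 \<le> 2 * h * b + h\<^sup>2 * a"
  shows "b \<ge> 0"
proof (rule ccontr)
  assume "\<not> b \<ge> 0"
  \<comment> \<open>The denominator \<open>a + 1\<close> is positive even for \<open>a = 0\<close>,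
    and it gives \<open>h * a < - b\<close>, so that \<open>2 * b + h * a\<close> stays below
    \<open>b\<close>.\<close>
  define h where "h = min 1 (- b / (a + 1))"
  have h: "0 < h" "h \<le> 1" using assms \<open>\<not> b \<ge> 0\<close> by (auto simp: h_def divide_neg_pos)
  have "h * (a + 1) \<le> - b" 
    using assms by (simp add: h_def flip: pos_le_divide_eq)
  then have "2 * b + h * a < 0"
    using h \<open>\<not> b \<ge> 0\<close> by (simp add: algebra_simps)
  then have "h * (2 * b + h * a) < 0" using h by (simp add: mult_pos_neg)
  with *[OF h] show False by (simp add: algebra_simps power2_eq_square)
qed

text \<open>The separating functional is \<open>l - y\<close> for a point \<open>l\<close> of the closure of \<open>M\<close> nearest to \<open>y\<close>.\<close>

lemma cone_separation:
  fixes M :: "('i \<Rightarrow> real) set"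
  assumes "finite I" and "M \<noteq> {}"
    and add: "\<And>a b. a \<in> M \<Longrightarrow> b \<in> M \<Longrightarrow> (\<lambda>i. a i + b i) \<in> M"
    and scale: "\<And>t a. t \<ge> 0 \<Longrightarrow> a \<in> M \<Longrightarrow> (\<lambda>i. t * a i) \<in> M"
  obtains
    (limit) s where "\<And>k. s k \<in> M" "\<And>i. i \<in> I \<Longrightarrow> (\<lambda>k. s k i) \<longlonglongrightarrow> y i"
  | (separated) s l where "\<And>k :: nat. s k \<in> M" "\<And>i. i \<in> I \<Longrightarrow> (\<lambda>k. s k i) \<longlonglongrightarrow> l i"
      "\<And>c. c \<in> M \<Longrightarrow> 0 \<le> (\<Sum>i\<in>I. (l i - y i) * c i)" "(\<Sum>i\<in>I. (l i - y i) * y i) < 0"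
proof -
  define D where "D = (\<lambda>c. \<Sum>i\<in>I. (c i - y i)\<^sup>2)"
  define \<delta> where "\<delta> = (INF c\<in>M. D c)"
  have D0: "D c \<ge> 0" for c by (simp add: D_def sum_nonneg)
  have bdd: "bdd_below (D ` M)" using D0 by (auto simp: bdd_below_def)
  have \<delta>_le: "\<delta> \<le> D c" if "c \<in> M" for c
    unfolding \<delta>_def using bdd that by (rule cINF_lower)
  \<comment> \<open>Near-minimisers of the squared distance to \<open>y\<close>; their coordinates
    stay bounded, so a subsequence converges.\<close>
  have "\<exists>c\<in>M. D c < \<delta> + 1 / real (Suc k)" for k
    using cINF_less_iff[OF \<open>M \<noteq> {}\<close> bdd, of "\<delta> + 1 / real (Suc k)"]
    by (simp add: \<delta>_def)
  then obtain s where s: "\<And>k. s k \<in> M" "\<And>k. D (s k) < \<delta> + 1 / real (Suc k)" by metis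
  have "Bseq (\<lambda>k. s k i)" if i: "i \<in> I" for i
  proof (rule BseqI')
    fix k
    have "(s k i - y i)\<^sup>2 \<le> D (s k)"
      unfolding D_def using \<open>finite I\<close> i by (intro member_le_sum) auto
    also have "\<dots> < \<delta> + 1 / real (Suc k)" by (rule s)
    also have "\<dots> \<le> \<delta> + 1" by simp
    finally have "(s k i - y i)\<^sup>2 < \<delta> + 1" .
    moreover have "\<bar>s k i - y i\<bar> \<le> (s k i - y i)\<^sup>2 + 1" by (rule abs_le_square_plus_one)
    ultimately show "norm (s k i) \<le> \<delta> + 2 + \<bar>y i\<bar>" by simp
  qed
  then obtain r l where r: "strict_mono (r :: nat \<Rightarrow> nat)"
    and l: "\<And>i. i \<in> I \<Longrightarrow> (\<lambda>k. s (r k) i) \<longlonglongrightarrow> l i"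
    using finite_family_convergent_subseq[OF \<open>finite I\<close>, of s] by blast
  \<comment> \<open>\<open>l\<close> need not lie in \<open>M\<close>, but the points
    \<open>p * s (r k) + h * c\<close> do, and \<open>D\<close> is continuous, so the infimum
    \<open>\<delta>\<close> also bounds \<open>D\<close> at their limits.\<close>
  have lim: "\<delta> \<le> D (\<lambda>i. p * l i + h * c i)" if "p \<ge> 0" "h \<ge> 0" "c \<in> M" for p h c
  proof (rule LIMSEQ_le_const)
    show "(\<lambda>k. D (\<lambda>i. p * s (r k) i + h * c i)) \<longlonglongrightarrow> D (\<lambda>i. p * l i + h * c i)"
      unfolding D_def by (intro tendsto_intros l)
    show "\<exists>N. \<forall>k\<ge>N. \<delta> \<le> D (\<lambda>i. p * s (r k) i + h * c i)"
      using that s by (intro exI allI impI \<delta>_le add scale)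
  qed
  have "(\<lambda>k. D (s (r k))) \<longlonglongrightarrow> D l"
    unfolding D_def by (intro tendsto_intros l)
  moreover have "(\<lambda>k. \<delta> + 1 / real (Suc (r k))) \<longlonglongrightarrow> \<delta> + 0"
    using LIMSEQ_subseq_LIMSEQ[OF LIMSEQ_inverse_real_of_nat r]
    by (intro tendsto_intros) (simp add: o_def inverse_eq_divide)
  ultimately have "D l \<le> \<delta> + 0"
    using s(2) by (intro LIMSEQ_le) (auto intro: less_imp_le)
  moreover obtain c0 where c0: "c0 \<in> M" using \<open>M \<noteq> {}\<close> by blast
  moreover have "\<delta> \<le> D l" using lim[of 1 0 c0] c0 by simp
  ultimately have Dl: "D l = \<delta>" by simp
  \<comment> \<open>Optimality of \<open>l\<close> becomes a statement about a quadratic in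
    \<open>h\<close> whose linear coefficient is twice the pairing of \<open>c\<close> with
    \<open>l - y\<close>.\<close>
  have expand: "D (\<lambda>i. l i + h * c i) =
      \<delta> + (2 * h * (\<Sum>i\<in>I. (l i - y i) * c i) + h\<^sup>2 * (\<Sum>i\<in>I. (c i)\<^sup>2))" for h c
    unfolding Dl[symmetric] D_def sum_distrib_left sum.distrib[symmetric]
    by (intro sum.cong) (auto simp: power2_eq_square algebra_simps)
  show ?thesis
  proof (cases "\<delta> = 0")
    case True
    then have "\<forall>i\<in>I. (l i - y i)\<^sup>2 = 0"
      using Dl \<open>finite I\<close> by (subst sum_nonneg_eq_0_iff[symmetric]) (auto simp: D_def)
    then show ?thesis using limit[of "s \<circ> r"] s l by simp
  next
    case False
    have "0 \<le> (\<Sum>i\<in>I. (l i - y i) * c i)" if "c \<in> M" for c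
    proof (rule linear_part_nonneg)
      fix h :: real assume "0 < h"
      then show "0 \<le> 2 * h * (\<Sum>i\<in>I. (l i - y i) * c i) + h\<^sup>2 * (\<Sum>i\<in>I. (c i)\<^sup>2)"
        using lim[of 1 h c] that expand[of h c] by simp
    qed (simp add: sum_nonneg)
    \<comment> \<open>Shrinking \<open>l\<close> towards the apex 0 cannot bring it closer to
      \<open>y\<close>; \<open>c0\<close> enters with factor 0, merely to supply a member of
      \<open>M\<close>.\<close>
    moreover have "0 \<le> - (\<Sum>i\<in>I. (l i - y i) * l i)"
    proof (rule linear_part_nonneg)
      fix h :: real assume h: "0 < h" "h \<le> 1"
      have "\<delta> \<le> D (\<lambda>i. (1 - h) * l i + 0 * c0 i)" using h c0 by (intro lim) auto
      also have "(\<lambda>i. (1 - h) * l i + 0 * c0 i) = (\<lambda>i. l i + (- h) * l i)"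
        by (simp add: algebra_simps)
      finally show "0 \<le> 2 * h * - (\<Sum>i\<in>I. (l i - y i) * l i) + h\<^sup>2 * (\<Sum>i\<in>I. (l i)\<^sup>2)"
        using expand[of "- h" l] by simp
    qed (simp add: sum_nonneg)
    moreover have "(\<Sum>i\<in>I. (l i - y i) * y i) = (\<Sum>i\<in>I. (l i - y i) * l i) - \<delta>"
      unfolding Dl[symmetric] D_def sum_subtractf[symmetric]
      by (intro sum.cong) (auto simp: power2_eq_square algebra_simps)
    moreover have "\<delta> > 0" using False Dl D0[of l] by simp
    ultimately show ?thesis
      using separated[of "s \<circ> r" l] s(1) l by simp
  qed
qed

section \<open>Gram matrices and the number of squares\<close>

text \<open>Cholesky factorization by induction on the index set: the pivot \<open>p\<close> is
  split off and the Schur complement remains. A zero pivot forces its whole row to vanish.\<close>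

lemma psd_gram_factorization:
  fixes G :: "'i \<Rightarrow> 'i \<Rightarrow> real"
  assumes "finite J"
    and "\<And>a b. a \<in> J \<Longrightarrow> b \<in> J \<Longrightarrow> G a b = G b a"
    and "\<And>z. 0 \<le> (\<Sum>a\<in>J. \<Sum>b\<in>J. z a * z b * G a b)"
  shows "\<exists>w. \<forall>a\<in>J. \<forall>b\<in>J. G a b = (\<Sum>i\<in>J. w i a * w i b)"
  using assms
proof (induction J arbitrary: G rule: finite_induct)
  case empty
  then show ?case by simp
next
  case (insert p J)
  define S where "S = (\<lambda>z. \<Sum>b\<in>J. z b * G p b)"
  define Q where "Q = (\<lambda>z. \<Sum>a\<in>J. \<Sum>b\<in>J. z a * z b * G a b)"
  have expand: "(\<Sum>a\<in>insert p J. \<Sum>b\<in>insert p J. z a * z b * G a b) =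
      (z p)\<^sup>2 * G p p + 2 * z p * S z + Q z" for z
  proof -
    have "(\<Sum>a\<in>J. z a * z p * G a p) = z p * S z"
      unfolding S_def sum_distrib_left using insert.prems(1) by (intro sum.cong) auto
    moreover have "(\<Sum>b\<in>J. z p * z b * G p b) = z p * S z"
      unfolding S_def sum_distrib_left by (intro sum.cong) auto
    ultimately show ?thesis using insert.hyps
      by (simp add: Q_def sum.distrib power2_eq_square)
  qed
  \<comment> \<open>\<open>S\<close> and \<open>Q\<close> never look at \<open>z p\<close>, so that
    entry may be replaced by any \<open>t\<close>, which yields a nonnegative quadratic in
    \<open>t\<close>.\<close>
  have psd: "0 \<le> t\<^sup>2 * G p p + 2 * t * S z + Q z" for t z
  proof -
    have SQ: "S (z(p := t)) = S z" "Q (z(p := t)) = Q z"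
      unfolding S_def Q_def using insert.hyps by (auto intro!: sum.cong)
    then show ?thesis using insert.prems(2)[of "z(p := t)"] unfolding expand SQ by simp
  qed
  have "G p p \<ge> 0" using psd[of 1 "\<lambda>_. 0"] by (simp add: S_def Q_def)
  then consider "G p p = 0" | "G p p > 0" by linarith
  then show ?case
  proof cases
    case 1
    have "0 \<le> Q z" for z using psd[of 0 z] by simp
    then obtain w where w: "\<forall>a\<in>J. \<forall>b\<in>J. G a b = (\<Sum>i\<in>J. w i a * w i b)"
      using insert.IH[of G] insert.prems(1) unfolding Q_def by blast
    have zero: "G p b = 0" if b: "b \<in> J" for b
    proof (rule ccontr)
      assume "G p b \<noteq> 0"
      \<comment> \<open>With a zero pivot the quadratic in \<open>t\<close> is affine. At the unit
        vector of \<open>b\<close> its slope is \<open>2 * G p b\<close>, and the \<open>t\<close>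
        chosen below gives it the value -1.\<close>
      define z where "z = (\<lambda>a. if a = b then 1 else 0 :: real)"
      have "S z = (\<Sum>a\<in>J. if a = b then G p b else 0)"
        unfolding S_def by (intro sum.cong) (auto simp: z_def)
      then have "S z = G p b" using b insert.hyps by simp
      then show False
        using psd[of "- (Q z + 1) / (2 * G p b)" z] 1 \<open>G p b \<noteq> 0\<close> by (simp add: field_simps)
    qed
    define w' where "w' = (\<lambda>i a. if i = p \<or> a = p then 0 else w i a)"
    have "G a b = (\<Sum>i\<in>insert p J. w' i a * w' i b)" if "a \<in> insert p J" "b \<in> insert p J" for a b
    proof (cases "a = p \<or> b = p")
      case True
      then have "G a b = 0" using that 1 zero insert.prems(1) by (metis insertE)
      with True show ?thesis by (auto simp: w'_def)
    next
      case False
      have "(\<Sum>i\<in>insert p J. w' i a * w' i b) = (\<Sum>i\<in>J. w' i a * w' i b)"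
        using insert.hyps by (simp add: w'_def)
      also have "\<dots> = (\<Sum>i\<in>J. w i a * w i b)"
        using insert.hyps False by (intro sum.cong) (auto simp: w'_def)
      finally show ?thesis using w that False by simp
    qed
    then show ?thesis by blast
  next
    case 2
    \<comment> \<open>The Schur complement of the pivot.\<close>
    define G' where "G' = (\<lambda>a b. G a b - G p a * G p b / G p p)"
    have "0 \<le> (\<Sum>a\<in>J. \<Sum>b\<in>J. z a * z b * G' a b)" for z
    proof -
      have "(\<Sum>a\<in>J. \<Sum>b\<in>J. z a * z b * G' a b) =
          Q z - (\<Sum>a\<in>J. \<Sum>b\<in>J. (z a * G p a) * (z b * G p b)) / G p p"
        unfolding Q_def sum_divide_distrib sum_subtractf[symmetric]
        by (intro sum.cong) (auto simp: G'_def algebra_simps)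
      also have "(\<Sum>a\<in>J. \<Sum>b\<in>J. (z a * G p a) * (z b * G p b)) = (S z)\<^sup>2"
        unfolding S_def power2_eq_square sum_product ..
      finally have eq: "(\<Sum>a\<in>J. \<Sum>b\<in>J. z a * z b * G' a b) = Q z - (S z)\<^sup>2 / G p p" .
      \<comment> \<open>The value of the quadratic at its minimiser
        \<open>t = - S z / G p p\<close>, which is exactly the Schur complement form at
        \<open>z\<close>.\<close>
      have "(- x / g)\<^sup>2 * g + 2 * (- x / g) * x + q = q - x\<^sup>2 / g" if "g > 0" for x g q :: real
        using that by (simp add: power2_eq_square field_simps)
      from this[OF 2, of "S z" "Q z"] show ?thesis using psd[of "- S z / G p p" z] unfolding eq by (simp only:)
    qed
    moreover have "G' a b = G' b a" if "a \<in> J" "b \<in> J" for a b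
      using insert.prems(1)[of a b] that by (simp add: G'_def)
    ultimately obtain w where w: "\<forall>a\<in>J. \<forall>b\<in>J. G' a b = (\<Sum>i\<in>J. w i a * w i b)"
      using insert.IH[of G'] by blast
    \<comment> \<open>Index \<open>p\<close> carries the new Cholesky row; the rows from the
      induction get entry 0 in column \<open>p\<close>.\<close>
    define w' where "w' = (\<lambda>i a. if i = p then G p a / sqrt (G p p) else if a = p then 0 else w i a)"
    have "G a b = (\<Sum>i\<in>insert p J. w' i a * w' i b)" if ab: "a \<in> insert p J" "b \<in> insert p J" for a b
    proof -
      have "w' p a * w' p b = G p a * G p b / G p p" using 2 by (simp add: w'_def)
      moreover have "(\<Sum>i\<in>J. w' i a * w' i b) = G a b - G p a * G p b / G p p"
      proof (cases "a = p \<or> b = p")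
        case True
        then have "(\<Sum>i\<in>J. w' i a * w' i b) = 0"
          using insert.hyps by (intro sum.neutral) (auto simp: w'_def)
        moreover have "G a b = G p a * G p b / G p p"
          using True 2 ab insert.prems(1)[of a p] by auto
        ultimately show ?thesis by simp
      next
        case False
        have "(\<Sum>i\<in>J. w' i a * w' i b) = (\<Sum>i\<in>J. w i a * w i b)"
          using insert.hyps False by (intro sum.cong) (auto simp: w'_def)
        then show ?thesis using w ab False by (simp add: G'_def)
      qed
      ultimately show ?thesis using insert.hyps by simp
    qed
    then show ?thesis by blast
  qed
qed

text \<open>The sum depends on the coefficients only through their Gram matrix, which factors again
  with one square per element of \<open>J\<close>. A number of squares independent of the form is
  what allows limits to be taken.\<close>

lemma sum_squares_reduce:
  fixes c :: "'k \<Rightarrow> 'i \<Rightarrow> real"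
  assumes "finite J"
  obtains w where "\<And>z. (\<Sum>k\<in>K. (\<Sum>e\<in>J. c k e * z e)\<^sup>2) = (\<Sum>i\<in>J. (\<Sum>e\<in>J. w i e * z e)\<^sup>2)"
proof -
  \<comment> \<open>Stated for any index type, since it is applied to the given squares and again to
    the factored ones.\<close>
  have gram: "(\<Sum>k\<in>K. (\<Sum>e\<in>J. c k e * z e)\<^sup>2) =
      (\<Sum>a\<in>J. \<Sum>b\<in>J. z a * z b * (\<Sum>k\<in>K. c k a * c k b))" for z and K :: "'l set" and c :: "'l \<Rightarrow> 'i \<Rightarrow> real"
  proof -
    have "(\<Sum>k\<in>K. (\<Sum>e\<in>J. c k e * z e)\<^sup>2) =
        (\<Sum>k\<in>K. \<Sum>a\<in>J. \<Sum>b\<in>J. z a * z b * (c k a * c k b))"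
      unfolding power2_eq_square sum_product by (intro sum.cong) (auto simp: algebra_simps)
    also have "\<dots> = (\<Sum>a\<in>J. \<Sum>k\<in>K. \<Sum>b\<in>J. z a * z b * (c k a * c k b))" by (rule sum.swap)
    also have "\<dots> = (\<Sum>a\<in>J. \<Sum>b\<in>J. \<Sum>k\<in>K. z a * z b * (c k a * c k b))"
      by (intro sum.cong refl sum.swap)
    finally show ?thesis by (simp add: sum_distrib_left)
  qed
  have "0 \<le> (\<Sum>a\<in>J. \<Sum>b\<in>J. z a * z b * (\<Sum>k\<in>K. c k a * c k b))" for z
    unfolding gram[symmetric] by (simp add: sum_nonneg)
  then obtain w where w: "\<forall>a\<in>J. \<forall>b\<in>J. (\<Sum>k\<in>K. c k a * c k b) = (\<Sum>i\<in>J. w i a * w i b)"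
    using psd_gram_factorization[OF assms, of "\<lambda>a b. \<Sum>k\<in>K. c k a * c k b"]
    by (auto simp: mult.commute)
  have "(\<Sum>k\<in>K. (\<Sum>e\<in>J. c k e * z e)\<^sup>2) = (\<Sum>i\<in>J. (\<Sum>e\<in>J. w i e * z e)\<^sup>2)" for z
    unfolding gram using w by (intro sum.cong) auto
  then show ?thesis by (rule that)
qed

section \<open>Vandermonde matrices\<close>

lemma vandermonde_mat_carrier [simp]: "vandermonde_mat N u \<in> carrier_mat N N"
  by (simp add: vandermonde_mat_def)

text \<open>A kernel vector of the transpose lists the coefficients of a polynomial of degree below
  \<open>N\<close> with \<open>N\<close> distinct roots.\<close>

lemma det_transpose_vandermonde:
  assumes "inj_on u {..<N}"
  shows "det (transpose_mat (vandermonde_mat N u)) \<noteq> 0"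
proof
  let ?V = "transpose_mat (vandermonde_mat N u)"
  assume "det ?V = 0"
  moreover have "?V \<in> carrier_mat N N" by simp
  ultimately obtain v where v: "v \<in> carrier_vec N" "v \<noteq> 0\<^sub>v N" "?V *\<^sub>v v = 0\<^sub>v N"
    using det_0_iff_vec_prod_zero by blast
  from v(1,2) have "N > 0" by (cases "N = 0") auto
  define p where "p = (\<Sum>i<N. Polynomial.monom (v $ i) i)"
  have "poly p x = 0" if "x \<in> u ` {..<N}" for x
  proof -
    from that obtain k where k: "k < N" "x = u k" by auto
    then have "(?V *\<^sub>v v) $ k = 0" using v(3) by simp
    also have "(?V *\<^sub>v v) $ k = poly p x"
      using k v(1) by (simp add: vandermonde_mat_def p_def scalar_prod_def poly_sum poly_monom
          lessThan_atLeast0 mult.commute)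
    finally show ?thesis .
  qed
  moreover have "degree p < N"
    unfolding p_def using \<open>N > 0\<close>
    by (intro degree_sum_less) (auto intro: le_less_trans[OF degree_monom_le])
  moreover have "card (u ` {..<N}) = N" using assms by (simp add: card_image)
  ultimately have "p = 0"
    using poly_eqI_degree[of "u ` {..<N}" p 0] by simp
  have "v $ i = 0" if "i < N" for i
  proof -
    have "v $ i = Polynomial.coeff p i" using that by (simp add: p_def coeff_sum)
    then show ?thesis using \<open>p = 0\<close> by simp
  qed
  then show False using v(1,2) by auto
qed

text \<open>Read columnwise, the inverse gives weights that extract single coefficients of a
  polynomial from its values at the nodes.\<close>

lemma vandermonde_right_inverse:
  assumes "inj_on u {..<N}"
  obtains W where "W \<in> carrier_mat N N" "vandermonde_mat N u * W = 1\<^sub>m N"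
proof -
  have "det (vandermonde_mat N u) \<noteq> 0"
    using det_transpose_vandermonde[OF assms] det_transpose[OF vandermonde_mat_carrier] by metis
  then have "vandermonde_mat N u \<in> Units (ring_mat TYPE(real) N ())"
    by (intro det_non_zero_imp_unit) simp
  then show ?thesis using that unfolding Units_def ring_mat_simps by auto
qed

section \<open>Forms and sums of squares\<close>

definition monom_val :: "nat \<Rightarrow> (nat \<Rightarrow> nat) \<Rightarrow> real Matrix.vec \<Rightarrow> real" where
  "monom_val n e x = (\<Prod>i<n. (x $ i) ^ e i)"

text \<open>Requiring zeros from \<open>n\<close> on gives each monomial a unique exponent function
  and makes the set finite.\<close>

definition exponents :: "nat \<Rightarrow> nat \<Rightarrow> (nat \<Rightarrow> nat) set" where
  "exponents n d = {e. (\<forall>i\<ge>n. e i = 0) \<and> (\<Sum>i<n. e i) = d}"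

lemma exponents_le: "e \<in> exponents n d \<Longrightarrow> i < n \<Longrightarrow> e i \<le> d"
  unfolding exponents_def by (auto intro!: member_le_sum)

lemma finite_exponents [simp]: "finite (exponents n d)"
proof (rule finite_subset)
  show "exponents n d \<subseteq> {e. \<forall>i. (i \<in> {..<n} \<longrightarrow> e i \<in> {..d}) \<and> (i \<notin> {..<n} \<longrightarrow> e i = 0)}"
    using exponents_le[of _ n d] by (auto simp: exponents_def not_less)
qed (intro finite_set_of_finite_funs; simp)

text \<open>A normal form with one coefficient per monomial: exponent functions that agree below
  \<open>n\<close> are merged.\<close>

lemma homogeneous_poly_fun_iff:
  "homogeneous_poly_fun n d f \<longleftrightarrow>
    (\<exists>c. \<forall>x\<in>carrier_vec n. f x = (\<Sum>e\<in>exponents n d. c e * monom_val n e x))"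
proof
  assume "\<exists>c. \<forall>x\<in>carrier_vec n. f x = (\<Sum>e\<in>exponents n d. c e * monom_val n e x)"
  then obtain c where "\<forall>x\<in>carrier_vec n. f x = (\<Sum>e\<in>exponents n d. c e * monom_val n e x)" ..
  then show "homogeneous_poly_fun n d f"
    unfolding homogeneous_poly_fun_def monom_val_def
    by (intro exI[of _ "exponents n d"] exI[of _ c] conjI finite_exponents)
      (auto simp: exponents_def)
next
  assume "homogeneous_poly_fun n d f"
  then obtain E c where E: "finite E" "\<forall>e\<in>E. (\<Sum>i<n. e i) = d"
    and fE: "\<forall>x\<in>carrier_vec n. f x = (\<Sum>e\<in>E. c e * monom_val n e x)"
    unfolding homogeneous_poly_fun_def monom_val_def by (elim exE conjE)
  have f: "f x = (\<Sum>e\<in>E. c e * monom_val n e x)" if "x \<in> carrier_vec n" for x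
    using fE that by (rule bspec)
  define trunc where "trunc = (\<lambda>e i. if i < n then e i else 0 :: nat)"
  have trunc: "monom_val n (trunc e) x = monom_val n e x" for e x
    by (simp add: monom_val_def trunc_def)
  have "trunc ` E \<subseteq> exponents n d" using E(2) by (auto simp: exponents_def trunc_def)
  have "f x = (\<Sum>e\<in>exponents n d. (\<Sum>e'\<in>{e'\<in>E. trunc e' = e}. c e') * monom_val n e x)"
    if "x \<in> carrier_vec n" for x
  proof -
    have "f x = (\<Sum>e\<in>exponents n d. \<Sum>e'\<in>{e'\<in>E. trunc e' = e}. c e' * monom_val n e' x)"
      unfolding f[OF that]
      by (rule sum.group[OF E(1) finite_exponents \<open>trunc ` E \<subseteq> exponents n d\<close>, symmetric])
    also have "\<dots> = (\<Sum>e\<in>exponents n d. \<Sum>e'\<in>{e'\<in>E. trunc e' = e}. c e' * monom_val n e x)"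
      using trunc by (intro sum.cong) auto
    finally show ?thesis by (simp add: sum_distrib_right)
  qed
  then show "\<exists>c. \<forall>x\<in>carrier_vec n. f x = (\<Sum>e\<in>exponents n d. c e * monom_val n e x)"
    by (intro exI ballI)
qed

section \<open>Recovering coefficients from values\<close>

text \<open>Uniqueness of base \<open>B\<close> digits: reduction mod \<open>B\<close> gives the
  lowest digit, and induction handles the rest.\<close>

lemma digit_sum_inject:
  fixes e f :: "nat \<Rightarrow> nat"
  assumes "\<And>i. i < n \<Longrightarrow> e i < B" "\<And>i. i < n \<Longrightarrow> f i < B"
    and "(\<Sum>i<n. e i * B ^ i) = (\<Sum>i<n. f i * B ^ i)" and "i < n"
  shows "e i = f i"
  using assms
proof (induction n arbitrary: e f i)
  case (Suc n)
  have shift: "(\<Sum>i<Suc n. g i * B ^ i) = g 0 + B * (\<Sum>i<n. g (Suc i) * B ^ i)" for g :: "nat \<Rightarrow> nat"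
    by (simp add: sum.lessThan_Suc_shift sum_distrib_left mult.left_commute del: sum.lessThan_Suc)
  have eq: "e 0 + B * (\<Sum>i<n. e (Suc i) * B ^ i) = f 0 + B * (\<Sum>i<n. f (Suc i) * B ^ i)"
    using Suc.prems(3) unfolding shift .
  from arg_cong[OF this, of "\<lambda>k. k mod B"] have "e 0 = f 0"
    using Suc.prems(1)[of 0] Suc.prems(2)[of 0] by simp
  moreover have "B > 0" using Suc.prems(1)[of 0] by simp
  ultimately have "(\<Sum>i<n. e (Suc i) * B ^ i) = (\<Sum>i<n. f (Suc i) * B ^ i)" using eq by simp
  then have "e (Suc j) = f (Suc j)" if "j < n" for j
    using Suc.IH[of "\<lambda>i. e (Suc i)" "\<lambda>i. f (Suc i)" j] Suc.prems(1,2) that by simp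
  then show ?case using \<open>e 0 = f 0\<close> Suc.prems(4) by (cases i) auto
qed simp

text \<open>Kronecker substitution \<open>x\<^sub>i = s ^ (B ^ i)\<close> sends distinct monomials to distinct powers
  of \<open>s\<close>, so that an inverse Vandermonde matrix recovers the coefficients from values.\<close>

lemma coefficient_from_values:
  assumes "e \<in> exponents n d"
  shows "\<exists>(M :: nat) X l. (\<forall>s. X s \<in> carrier_vec n) \<and>
    (\<forall>c. c e = (\<Sum>s<M. l s * (\<Sum>e'\<in>exponents n d. c e' * monom_val n e' (X s))))"
proof -
  \<comment> \<open>Every exponent in a form of degree \<open>d\<close> is at most \<open>d\<close>,
    hence a digit in base \<open>Suc d\<close>; \<open>code e\<close> is the power of
    \<open>s\<close> that the monomial becomes.\<close>
  define B where "B = Suc d"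
  define code where "code = (\<lambda>e. \<Sum>i<n. e i * B ^ i)"
  define M where "M = Suc (Max (code ` exponents n d))"
  define X where "X = (\<lambda>s. Matrix.vec n (\<lambda>i. real s ^ B ^ i))"
  have code_less: "code e < M" if "e \<in> exponents n d" for e
    unfolding M_def less_Suc_eq_le using that by (intro Max_ge) auto
  have code_inj: "e = f" if ef: "e \<in> exponents n d" "f \<in> exponents n d" "code e = code f" for e f
  proof
    fix i
    have "e i = f i" if "i < n"
      using digit_sum_inject[of n e B f i] ef exponents_le that
      by (simp add: code_def B_def less_Suc_eq_le)
    then show "e i = f i" using ef by (cases "i < n") (auto simp: exponents_def)
  qed
  have "inj_on real {..<M}" by (simp add: inj_on_def)
  then obtain W where W: "W \<in> carrier_mat M M" "vandermonde_mat M real * W = 1\<^sub>m M"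
    by (rule vandermonde_right_inverse)
  have "monom_val n e' (X s) = real s ^ code e'" for e' s
    unfolding monom_val_def code_def power_sum
    by (intro prod.cong) (auto simp: X_def mult.commute simp flip: power_mult)
  \<comment> \<open>Used as weights on the values at \<open>s\<close>, column \<open>code e\<close>
    of \<open>W\<close> annihilates every power of \<open>s\<close> below \<open>M\<close> except
    \<open>s ^ code e\<close>.\<close>
  then have dual: "(\<Sum>s<M. W $$ (s, code e) * monom_val n e' (X s)) = (if e' = e then 1 else 0)"
    if "e' \<in> exponents n d" for e'
  proof -
    have "(\<Sum>s<M. W $$ (s, code e) * real s ^ code e') = (vandermonde_mat M real * W) $$ (code e', code e)"
      using W(1) code_less[OF that] code_less[OF assms]
      by (simp add: vandermonde_mat_def scalar_prod_def lessThan_atLeast0 mult.commute)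
    also have "\<dots> = (if e' = e then 1 else 0)"
      using W(2) code_less[OF that] code_less[OF assms] code_inj[OF that assms] by auto
    finally show ?thesis using \<open>\<And>s e'. monom_val n e' (X s) = real s ^ code e'\<close> by simp
  qed
  have "c e = (\<Sum>s<M. W $$ (s, code e) * (\<Sum>e'\<in>exponents n d. c e' * monom_val n e' (X s)))" for c
  proof -
    have "(\<Sum>s<M. W $$ (s, code e) * (\<Sum>e'\<in>exponents n d. c e' * monom_val n e' (X s))) =
        (\<Sum>s<M. \<Sum>e'\<in>exponents n d. c e' * (W $$ (s, code e) * monom_val n e' (X s)))"
      by (simp add: sum_distrib_left mult.left_commute)
    also have "\<dots> = (\<Sum>e'\<in>exponents n d. \<Sum>s<M. c e' * (W $$ (s, code e) * monom_val n e' (X s)))"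
      by (rule sum.swap)
    also have "\<dots> = (\<Sum>e'\<in>exponents n d. c e' * (if e' = e then 1 else 0))"
      using dual by (simp flip: sum_distrib_left)
    also have "\<dots> = (\<Sum>e'\<in>exponents n d. if e' = e then c e' else 0)" by (intro sum.cong) auto
    also have "\<dots> = c e" using assms by simp
    finally show ?thesis ..
  qed
  moreover have "X s \<in> carrier_vec n" for s by (simp add: X_def)
  ultimately show ?thesis
    by (intro exI[of _ M] exI[of _ X] exI[of _ "\<lambda>s. W $$ (s, code e)"]) blast
qed

text \<open>Induction peels off factors of \<open>t\<close>: for positive \<open>d\<close> the bound
  makes the constant term vanish, and for \<open>d = 0\<close> a bounded polynomial is
  constant.\<close>

lemma poly_bounded_by_power:
  fixes q :: "real poly"
  assumes "\<And>t. t \<noteq> 0 \<Longrightarrow> \<bar>poly q t\<bar> \<le> C * \<bar>t\<bar> ^ d"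
  shows "q = Polynomial.monom (Polynomial.coeff q d) d"
  using assms
proof (induction d arbitrary: q)
  case 0
  obtain a p where q: "q = pCons a p" by (cases q)
  have "p = 0"
  proof (rule ccontr)
    assume "p \<noteq> 0"
    from poly_infinity[OF this, of "C + 1" a] obtain r
      where r: "\<And>z. r \<le> norm z \<Longrightarrow> C + 1 \<le> norm (poly q z)" unfolding q by blast
    define z where "z = max r 1"
    have "r \<le> norm z" "z \<noteq> 0" by (auto simp: z_def)
    with r[of z] 0[of z] show False by simp
  qed
  then show ?case by (simp add: q monom_0)
next
  case (Suc d)
  \<comment> \<open>The bound is assumed only away from 0, so the value at 0 is controlled by a
    limit.\<close>
  have "((\<lambda>t. C * \<bar>t\<bar> ^ Suc d) \<longlongrightarrow> C * \<bar>0 :: real\<bar> ^ Suc d) (at 0)" by (intro tendsto_intros)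
  moreover have "((\<lambda>t. \<bar>poly q t\<bar>) \<longlongrightarrow> \<bar>poly q 0\<bar>) (at 0)" by (intro tendsto_intros)
  moreover have "\<forall>\<^sub>F t in at 0. \<bar>poly q t\<bar> \<le> C * \<bar>t\<bar> ^ Suc d"
    using Suc.prems by (simp add: eventually_at_filter)
  ultimately have "\<bar>poly q 0\<bar> \<le> C * \<bar>0 :: real\<bar> ^ Suc d"
    by (intro tendsto_le[of "at (0::real)"]) auto
  then obtain p where q: "q = pCons 0 p" by (cases q) simp
  have "\<bar>poly p t\<bar> \<le> C * \<bar>t\<bar> ^ d" if "t \<noteq> 0" for t
  proof -
    have "\<bar>t\<bar> * \<bar>poly p t\<bar> \<le> \<bar>t\<bar> * (C * \<bar>t\<bar> ^ d)"
      using Suc.prems[OF that] by (simp add: q abs_mult algebra_simps)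
    then show ?thesis using that by simp
  qed
  from Suc.IH[OF this] show ?case by (simp add: q monom_Suc)
qed

lemma monom_val_smult:
  assumes "x \<in> carrier_vec n"
  shows "monom_val n e (t \<cdot>\<^sub>v x) = t ^ (\<Sum>i<n. e i) * monom_val n e x"
  using assms by (simp add: monom_val_def power_mult_distrib prod.distrib power_sum)

text \<open>Along each ray a summand \<open>p\<close> satisfies \<open>\<bar>p (t x)\<bar> \<le> C \<bar>t\<bar> ^ d\<close>, both for small and for
  large \<open>t\<close>, so it is already homogeneous of degree \<open>d\<close>.\<close>

lemma homogeneous_square_summand:
  assumes p: "poly_fun n p"
    and f: "\<And>x t. x \<in> carrier_vec n \<Longrightarrow> f (t \<cdot>\<^sub>v x) = t ^ (2 * d) * f x"
    and le: "\<And>x. x \<in> carrier_vec n \<Longrightarrow> (p x)\<^sup>2 \<le> f x"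
  shows "homogeneous_poly_fun n d p"
proof -
  obtain E c where E: "finite E"
    and pE: "\<And>x. x \<in> carrier_vec n \<Longrightarrow> p x = (\<Sum>e\<in>E. c e * monom_val n e x)"
    using p unfolding poly_fun_def monom_val_def by blast
  have "p x = (\<Sum>e\<in>{e\<in>E. (\<Sum>i<n. e i) = d}. c e * monom_val n e x)" if x: "x \<in> carrier_vec n" for x
  proof -
    \<comment> \<open>The restriction of \<open>p\<close> to the ray through \<open>x\<close>; the
      terms with exponent sum \<open>d\<close> make up its coefficient of
      \<open>t ^ d\<close>.\<close>
    define q where "q = (\<Sum>e\<in>E. Polynomial.monom (c e * monom_val n e x) (\<Sum>i<n. e i))"
    have q: "poly q t = p (t \<cdot>\<^sub>v x)" for t
      using x by (auto simp: q_def poly_sum poly_monom pE monom_val_smult mult_ac intro!: sum.cong)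
    have "\<bar>poly q t\<bar> \<le> sqrt (f x) * \<bar>t\<bar> ^ d" for t
    proof -
      have "(poly q t)\<^sup>2 \<le> f x * (t ^ d)\<^sup>2"
        using le[of "t \<cdot>\<^sub>v x"] f[OF x, of t] x by (simp add: q mult.commute flip: power_mult)
      then have "sqrt ((poly q t)\<^sup>2) \<le> sqrt (f x * (t ^ d)\<^sup>2)" by (rule real_sqrt_le_mono)
      then show ?thesis by (simp add: real_sqrt_mult power_abs)
    qed
    then have "q = Polynomial.monom (Polynomial.coeff q d) d" by (rule poly_bounded_by_power)
    then have "poly q 1 = poly (Polynomial.monom (Polynomial.coeff q d) d) 1" by simp
    also have "\<dots> = Polynomial.coeff q d" by (simp add: poly_monom)
    also have "\<dots> = (\<Sum>e\<in>E. if (\<Sum>i<n. e i) = d then c e * monom_val n e x else 0)"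
      by (simp add: q_def coeff_sum)
    finally show ?thesis using E x by (simp add: q sum.inter_filter)
  qed
  then show ?thesis
    unfolding homogeneous_poly_fun_def using E
    by (intro exI[of _ "{e\<in>E. (\<Sum>i<n. e i) = d}"] exI[of _ c]) (simp add: monom_val_def)
qed

text \<open>Squares cannot cancel, so each is dominated by the homogeneous sum and inherits
  homogeneity. This reconciles \<open>SOS\<close>, stated with arbitrary polynomials, with
  \<open>HSOS\<close>, stated with forms.\<close>

lemma sum_of_squares_of_homogeneous_iff:
  assumes f: "\<And>x t. x \<in> carrier_vec n \<Longrightarrow> f (t \<cdot>\<^sub>v x) = t ^ (2 * d) * f x"
  shows "sum_of_squares_of (poly_fun n) n f \<longleftrightarrow> sum_of_squares_of (homogeneous_poly_fun n d) n f"
proof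
  assume "sum_of_squares_of (poly_fun n) n f"
  then obtain r :: nat and p where p: "\<And>j. j < r \<Longrightarrow> poly_fun n (p j)"
    and fp: "\<forall>x \<in> carrier_vec n. f x = (\<Sum>j<r. (p j x)\<^sup>2)"
    unfolding sum_of_squares_of_def by blast
  have "homogeneous_poly_fun n d (p j)" if "j < r" for j
    using p[OF that] f
  proof (rule homogeneous_square_summand)
    show "(p j x)\<^sup>2 \<le> f x" if "x \<in> carrier_vec n" for x
      using fp that \<open>j < r\<close> by (auto intro!: member_le_sum[of j _ "\<lambda>j. (p j x)\<^sup>2"])
  qed
  then show "sum_of_squares_of (homogeneous_poly_fun n d) n f"
    unfolding sum_of_squares_of_def using fp by blast
next
  assume "sum_of_squares_of (homogeneous_poly_fun n d) n f"
  moreover have "homogeneous_poly_fun n d p \<Longrightarrow> poly_fun n p" for p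
    unfolding homogeneous_poly_fun_def poly_fun_def by blast
  ultimately show "sum_of_squares_of (poly_fun n) n f"
    unfolding sum_of_squares_of_def by blast
qed

text \<open>Brings all sums of squares of forms into one shape, indexed by monomials on both levels,
  so that a sequence of them becomes a sequence of matrices \<open>w\<close>.\<close>

lemma homogeneous_sum_of_squares_iff:
  "sum_of_squares_of (homogeneous_poly_fun n d) n f \<longleftrightarrow>
    (\<exists>w. \<forall>x\<in>carrier_vec n.
      f x = (\<Sum>i\<in>exponents n d. (\<Sum>e\<in>exponents n d. w i e * monom_val n e x)\<^sup>2))"
  (is "?L \<longleftrightarrow> ?R")
proof
  assume ?L
  then obtain r :: nat and p where p: "\<forall>j<r. homogeneous_poly_fun n d (p j)"
    and f: "\<And>x. x \<in> carrier_vec n \<Longrightarrow> f x = (\<Sum>j<r. (p j x)\<^sup>2)"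
    unfolding sum_of_squares_of_def by blast
  have "\<forall>j. \<exists>c. j < r \<longrightarrow> (\<forall>x\<in>carrier_vec n. p j x = (\<Sum>e\<in>exponents n d. c e * monom_val n e x))"
    using p unfolding homogeneous_poly_fun_iff by blast
  from choice[OF this] obtain c where c: "\<And>j x. j < r \<Longrightarrow> x \<in> carrier_vec n \<Longrightarrow>
      p j x = (\<Sum>e\<in>exponents n d. c j e * monom_val n e x)"
    by blast
  obtain w where w: "\<And>z. (\<Sum>k<r. (\<Sum>e\<in>exponents n d. c k e * z e)\<^sup>2) =
      (\<Sum>i\<in>exponents n d. (\<Sum>e\<in>exponents n d. w i e * z e)\<^sup>2)"
    using sum_squares_reduce[OF finite_exponents[of n d], of c "{..<r}"] by blast
  show ?R
  proof (intro exI[of _ w] ballI)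
    fix x :: "real Matrix.vec" assume x: "x \<in> carrier_vec n"
    show "f x = (\<Sum>i\<in>exponents n d. (\<Sum>e\<in>exponents n d. w i e * monom_val n e x)\<^sup>2)"
      unfolding w[symmetric] f[OF x] using c x by (intro sum.cong) auto
  qed
next
  assume ?R
  then obtain w where w: "\<And>x. x \<in> carrier_vec n \<Longrightarrow>
      f x = (\<Sum>i\<in>exponents n d. (\<Sum>e\<in>exponents n d. w i e * monom_val n e x)\<^sup>2)" by blast
  obtain h where h: "bij_betw h {..<card (exponents n d)} (exponents n d)"
    using ex_bij_betw_nat_finite[OF finite_exponents] by (auto simp: lessThan_atLeast0)
  show ?L
    unfolding sum_of_squares_of_def homogeneous_poly_fun_iff
  proof (intro exI conjI allI impI ballI)
    show "(\<Sum>e\<in>exponents n d. w (h j) e * monom_val n e x) =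
        (\<Sum>e\<in>exponents n d. w (h j) e * monom_val n e x)" for j x ..
    show "f x = (\<Sum>j<card (exponents n d). (\<Sum>e\<in>exponents n d. w (h j) e * monom_val n e x)\<^sup>2)"
      if "x \<in> carrier_vec n" for x
      unfolding w[OF that] by (rule sum.reindex_bij_betw[OF h, symmetric])
  qed
qed

section \<open>Symmetric tensors\<close>

lemma finite_multi_indices [simp]: "finite (multi_indices m n)"
  by (rule finite_subset[OF _ finite_lists_length_eq[of "{..<n}" m]]) (auto simp: multi_indices_def)

lemma multi_indices_nth: "is \<in> multi_indices m n \<Longrightarrow> j < m \<Longrightarrow> is ! j < n"
  unfolding multi_indices_def using nth_mem by blast

lemma multi_indices_mset_cong:
  "is \<in> multi_indices m n \<Longrightarrow> mset js = mset is \<Longrightarrow> js \<in> multi_indices m n"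
  using mset_eq_length[of js "is"] mset_eq_setD[of js "is"] by (auto simp: multi_indices_def)

text \<open>The distributive expansion of an \<open>m\<close>-th power; it makes the form of a
  rank-one tensor the power of a linear form.\<close>

lemma sum_multi_indices_prod:
  fixes g :: "nat \<Rightarrow> real"
  shows "(\<Sum>is\<in>multi_indices m n. \<Prod>j<m. g (is ! j)) = (\<Sum>i<n. g i) ^ m"
proof (induction m)
  case 0
  have "multi_indices 0 n = {[]}" by (auto simp: multi_indices_def)
  then show ?case by simp
next
  case (Suc m)
  have "multi_indices (Suc m) n = (\<lambda>p. fst p # snd p) ` ({..<n} \<times> multi_indices m n)"
    by (auto simp: multi_indices_def length_Suc_conv image_iff)
  moreover have "inj_on (\<lambda>p. fst p # snd p) ({..<n} \<times> multi_indices m n)"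
    by (auto simp: inj_on_def)
  ultimately have "(\<Sum>is\<in>multi_indices (Suc m) n. \<Prod>j<Suc m. g (is ! j)) =
      (\<Sum>(i, is)\<in>{..<n} \<times> multi_indices m n. g i * (\<Prod>j<m. g (is ! j)))"
    by (simp add: sum.reindex case_prod_beta prod.lessThan_Suc_shift del: prod.lessThan_Suc)
  also have "\<dots> = (\<Sum>i<n. g i) * (\<Sum>is\<in>multi_indices m n. \<Prod>j<m. g (is ! j))"
    by (simp add: sum_product sum.cartesian_product)
  finally show ?case using Suc.IH by simp
qed

lemma symmetric_tensorsI:
  assumes "\<And>is. is \<notin> multi_indices m n \<Longrightarrow> A is = 0"
    and "\<And>is js. is \<in> multi_indices m n \<Longrightarrow> mset js = mset is \<Longrightarrow> A js = A is"
  shows "A \<in> symmetric_tensors m n"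
  using assms unfolding symmetric_tensors_def by blast

lemma symmetric_tensors_eq_0: "A \<in> symmetric_tensors m n \<Longrightarrow> is \<notin> multi_indices m n \<Longrightarrow> A is = 0"
  unfolding symmetric_tensors_def by blast

lemma symmetric_tensors_permute:
  "A \<in> symmetric_tensors m n \<Longrightarrow> is \<in> multi_indices m n \<Longrightarrow> mset js = mset is \<Longrightarrow> A js = A is"
  unfolding symmetric_tensors_def by blast

lemma rank_one_tensor_symmetric: "rank_one_tensor m n u \<in> symmetric_tensors m n"
proof (rule symmetric_tensorsI)
  \<comment> \<open>Written as a product over the multiset of indices, the entry is visibly
    invariant under permutations.\<close>
  have prod: "(\<Prod>j<m. u $ (is ! j)) = prod_mset (image_mset (($) u) (mset is))"
    if "is \<in> multi_indices m n" for "is"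
  proof -
    have "length is = m" using that by (simp add: multi_indices_def)
    then have "(\<Prod>j<m. u $ (is ! j)) = prod_list (map (($) u) is)"
      by (simp add: prod.list_conv_set_nth lessThan_atLeast0)
    also have "\<dots> = prod_mset (image_mset (($) u) (mset is))"
      by (simp add: prod_mset_prod_list flip: mset_map)
    finally show ?thesis .
  qed
  fix "is" js :: "nat list"
  assume "is": "is \<in> multi_indices m n" and js: "mset js = mset is"
  have "js \<in> multi_indices m n" using "is" js by (rule multi_indices_mset_cong)
  then show "rank_one_tensor m n u js = rank_one_tensor m n u is"
    using "is" js by (simp add: rank_one_tensor_def prod)
qed (simp add: rank_one_tensor_def)

lemma tensor_form_sum:
  "tensor_form m n (\<lambda>is. \<Sum>k\<in>K. a k * R k is) x = (\<Sum>k\<in>K. a k * tensor_form m n (R k) x)"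
  unfolding tensor_form_def sum_distrib_left sum_distrib_right
  by (subst sum.swap) (simp add: mult.assoc)

lemma tensor_inner_sum:
  "tensor_inner m n A (\<lambda>is. \<Sum>k\<in>K. a k * R k is) = (\<Sum>k\<in>K. a k * tensor_inner m n A (R k))"
  unfolding tensor_inner_def sum_distrib_left sum_distrib_right
  by (subst sum.swap) (simp add: mult.left_commute)

lemma tensor_form_rank_one:
  "tensor_form m n (rank_one_tensor m n u) x = (\<Sum>i<n. u $ i * x $ i) ^ m"
  unfolding sum_multi_indices_prod[symmetric] tensor_form_def rank_one_tensor_def
  by (simp add: prod.distrib)

lemma tensor_inner_rank_one:
  "tensor_inner m n A (rank_one_tensor m n u) = tensor_form m n A u"
  by (simp add: tensor_inner_def tensor_form_def rank_one_tensor_def)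

lemma tensor_form_smult:
  assumes "x \<in> carrier_vec n"
  shows "tensor_form m n A (t \<cdot>\<^sub>v x) = t ^ m * tensor_form m n A x"
  unfolding tensor_form_def sum_distrib_left
  using assms by (intro sum.cong) (auto simp: prod.distrib multi_indices_nth)

text \<open>The map \<open>L\<close> of the opening comment, linear in
  \<open>\<alpha>\<close>.\<close>

definition vandermonde_tensor :: "nat \<Rightarrow> nat \<Rightarrow> (nat \<Rightarrow> real) \<Rightarrow> real Matrix.vec \<Rightarrow> tensor" where
  "vandermonde_tensor m n u \<alpha> =
    (\<lambda>is. \<Sum>k = 0..(n - 1) * m. \<alpha> $ k * rank_one_tensor m n (vandermonde_vec n (u k)) is)"

lemma SG_iff:
  "\<alpha> \<in> SG m n u \<longleftrightarrow> \<alpha> \<in> carrier_vec ((n - 1) * m + 1) \<and> vandermonde_tensor m n u \<alpha> \<in> SOS m n"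
  by (simp add: SG_def vandermonde_tensor_def)

lemma vandermonde_tensor_symmetric: "vandermonde_tensor m n u \<alpha> \<in> symmetric_tensors m n"
proof (rule symmetric_tensorsI)
  fix "is" js assume *: "is \<in> multi_indices m n" "mset js = mset is"
  show "vandermonde_tensor m n u \<alpha> js = vandermonde_tensor m n u \<alpha> is"
    unfolding vandermonde_tensor_def
    by (intro sum.cong refl arg_cong2[of _ _ _ _ "(*)"]
        symmetric_tensors_permute[OF rank_one_tensor_symmetric *])
qed (simp add: vandermonde_tensor_def rank_one_tensor_def)

text \<open>Pairing with a rank-one tensor is evaluation at its vector, so the evaluation map is the
  adjoint of \<open>vandermonde_tensor\<close>.\<close>

lemma tensor_inner_vandermonde_tensor:
  "tensor_inner m n A (vandermonde_tensor m n u \<alpha>) =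
    (\<Sum>k<(n - 1) * m + 1. \<alpha> $ k * tensor_form m n A (vandermonde_vec n (u k)))"
  by (simp add: vandermonde_tensor_def tensor_inner_sum tensor_inner_rank_one
      atLeast0AtMost lessThan_Suc_atMost)

section \<open>Convolution and generating polynomials\<close>

definition gen_fun :: "real Matrix.vec \<Rightarrow> real \<Rightarrow> real" where
  "gen_fun x t = (\<Sum>i<dim_vec x. x $ i * t ^ i)"

text \<open>The Cauchy product: pairs of indices are grouped by their sum, the entry index of the
  convolution.\<close>

lemma gen_fun_convolution:
  assumes "dim_vec x > 0" and "dim_vec y > 0"
  shows "gen_fun (convolution x y) t = gen_fun x t * gen_fun y t"
proof -
  define S where "S = {..<dim_vec x} \<times> {..<dim_vec y}"
  define T where "T = {..<dim_vec x + dim_vec y - 1}"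
  define h where "h = (\<lambda>(i, j). x $ i * t ^ i * (y $ j * t ^ j))"
  have eq: "{(i1, i2). i1 + i2 = i \<and> i1 < dim_vec x \<and> i2 < dim_vec y} =
      {p \<in> S. (\<lambda>(i, j). i + j) p = i}" for i
    by (auto simp: S_def)
  have "gen_fun (convolution x y) t = (\<Sum>i\<in>T. \<Sum>p\<in>{p \<in> S. (\<lambda>(i, j). i + j) p = i}. h p)"
    unfolding gen_fun_def convolution_def T_def eq
    by (auto simp: sum_distrib_right h_def power_add intro!: sum.cong)
  also have "\<dots> = sum h S"
  proof (rule sum.group)
    show "(\<lambda>(i, j). i + j) ` S \<subseteq> T" by (auto simp: S_def T_def)
  qed (simp_all add: S_def T_def)
  also have "\<dots> = gen_fun x t * gen_fun y t"
    unfolding S_def h_def gen_fun_def sum_product sum.cartesian_product ..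
  finally show ?thesis .
qed

lemma gen_fun_conv_power:
  assumes "dim_vec x > 0"
  shows "gen_fun (conv_power x m) t = gen_fun x t ^ m"
proof (induction m)
  case 0
  show ?case by (simp add: gen_fun_def)
next
  case (Suc m)
  then show ?case using assms by (simp add: gen_fun_convolution dim_conv_power)
qed

lemma vandermonde_mat_scalar_prod:
  assumes "\<alpha> \<in> carrier_vec N" and "c \<in> carrier_vec N"
  shows "(vandermonde_mat N u *\<^sub>v \<alpha>) \<bullet> c = (\<Sum>k<N. \<alpha> $ k * gen_fun c (u k))"
proof -
  have "(vandermonde_mat N u *\<^sub>v \<alpha>) \<bullet> c = (\<Sum>i<N. \<Sum>k<N. \<alpha> $ k * (c $ i * u k ^ i))"
    using assms by (auto simp: scalar_prod_def vandermonde_mat_def lessThan_atLeast0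
        sum_distrib_left mult_ac intro!: sum.cong)
  also have "\<dots> = (\<Sum>k<N. \<alpha> $ k * gen_fun c (u k))"
    using assms by (subst sum.swap) (simp add: gen_fun_def sum_distrib_left)
  finally show ?thesis .
qed

text \<open>On both sides the node \<open>u k\<close> contributes \<open>\<alpha> $ k\<close> times
  the \<open>m\<close>-th power of \<open>gen_fun x (u k)\<close>, which is the pairing of
  \<open>x\<close> with the \<open>k\<close>-th Vandermonde vector.\<close>

lemma vandermonde_mat_conv_power:
  assumes "x \<in> carrier_vec n" and "n > 0" and "\<alpha> \<in> carrier_vec ((n - 1) * m + 1)"
  shows "(vandermonde_mat ((n - 1) * m + 1) u *\<^sub>v \<alpha>) \<bullet> conv_power x m =
    tensor_form m n (vandermonde_tensor m n u \<alpha>) x"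
proof -
  have "conv_power x m \<in> carrier_vec ((n - 1) * m + 1)"
    using assms dim_conv_power[of x m] by (intro carrier_vecI) auto
  then have "(vandermonde_mat ((n - 1) * m + 1) u *\<^sub>v \<alpha>) \<bullet> conv_power x m =
      (\<Sum>k<(n - 1) * m + 1. \<alpha> $ k * gen_fun x (u k) ^ m)"
    using assms by (subst vandermonde_mat_scalar_prod) (auto simp: gen_fun_conv_power)
  moreover have "gen_fun x t = (\<Sum>i<n. vandermonde_vec n t $ i * x $ i)" for t
    using assms by (simp add: gen_fun_def vandermonde_vec_def mult.commute)
  ultimately show ?thesis
    by (simp add: vandermonde_tensor_def tensor_form_sum tensor_form_rank_one
        atLeast0AtMost lessThan_Suc_atMost)
qed

lemma sum_of_squares_of_cong:
  assumes "\<And>x. x \<in> carrier_vec n \<Longrightarrow> f x = g x"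
  shows "sum_of_squares_of P n f \<longleftrightarrow> sum_of_squares_of P n g"
  using assms by (simp add: sum_of_squares_of_def)

lemma SOS_iff:
  assumes "even m"
  shows "A \<in> SOS m n \<longleftrightarrow> A \<in> symmetric_tensors m n \<and>
    sum_of_squares_of (homogeneous_poly_fun n (m div 2)) n (tensor_form m n A)"
  using assms sum_of_squares_of_homogeneous_iff[of n "tensor_form m n A" "m div 2"]
  by (simp add: SOS_def tensor_form_smult)

text \<open>Both memberships ask that one and the same function of \<open>x\<close> be a sum of
  squares of forms of degree \<open>m div 2\<close>.\<close>

lemma vandermonde_mat_HSOS_iff:
  assumes "even m" and "n > 0" and "\<alpha> \<in> carrier_vec ((n - 1) * m + 1)"
  shows "vandermonde_mat ((n - 1) * m + 1) u *\<^sub>v \<alpha> \<in> HSOS m n \<longleftrightarrow> \<alpha> \<in> SG m n u"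
proof -
  have "vandermonde_mat ((n - 1) * m + 1) u *\<^sub>v \<alpha> \<in> carrier_vec ((n - 1) * m + 1)"
    using vandermonde_mat_carrier assms(3) by (rule mult_mat_vec_carrier)
  then show ?thesis
    using assms vandermonde_tensor_symmetric
      sum_of_squares_of_cong[OF vandermonde_mat_conv_power[OF _ assms(2,3)]]
    by (simp add: HSOS_def SG_iff SOS_iff)
qed

section \<open>The cone of sums of squares and its bidual\<close>

lemma sum_of_squares_of_add:
  assumes "sum_of_squares_of P n f" and "sum_of_squares_of P n g"
  shows "sum_of_squares_of P n (\<lambda>x. f x + g x)"
proof -
  obtain r :: nat and p where p: "\<forall>j<r. P (p j)" "\<forall>x\<in>carrier_vec n. f x = (\<Sum>j<r. (p j x)\<^sup>2)"
    using assms(1) unfolding sum_of_squares_of_def by (elim exE conjE)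
  obtain s :: nat and q where q: "\<forall>j<s. P (q j)" "\<forall>x\<in>carrier_vec n. g x = (\<Sum>j<s. (q j x)\<^sup>2)"
    using assms(2) unfolding sum_of_squares_of_def by (elim exE conjE)
  have split: "(\<Sum>j<r + s. h j) = (\<Sum>j<r. h j) + (\<Sum>j<s. h (r + j))" for h :: "nat \<Rightarrow> real"
    by (induction s) (simp_all add: add.assoc)
  show ?thesis
    unfolding sum_of_squares_of_def
  proof (intro exI conjI)
    show "\<forall>j<r + s. P (if j < r then p j else q (j - r))" using p(1) q(1) by auto
    show "\<forall>x\<in>carrier_vec n. f x + g x = (\<Sum>j<r + s. ((if j < r then p j else q (j - r)) x)\<^sup>2)"
      using p(2) q(2) by (simp add: split)
  qed
qed

lemma poly_fun_scale:
  assumes "poly_fun n p"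
  shows "poly_fun n (\<lambda>x. a * p x)"
proof -
  obtain E :: "(nat \<Rightarrow> nat) set" and c where "finite E"
    "\<forall>x\<in>carrier_vec n. p x = (\<Sum>e\<in>E. c e * (\<Prod>i<n. (x $ i) ^ e i))"
    using assms unfolding poly_fun_def by (elim exE conjE)
  then show ?thesis
    unfolding poly_fun_def
    by (intro exI[of _ E] exI[of _ "\<lambda>e. a * c e"]) (simp add: sum_distrib_left mult.assoc)
qed

lemma sum_of_squares_of_scale:
  assumes "sum_of_squares_of (poly_fun n) n f" and "t \<ge> 0"
  shows "sum_of_squares_of (poly_fun n) n (\<lambda>x. t * f x)"
proof -
  obtain r :: nat and p where p: "\<forall>j<r. poly_fun n (p j)"
    "\<forall>x\<in>carrier_vec n. f x = (\<Sum>j<r. (p j x)\<^sup>2)"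
    using assms(1) unfolding sum_of_squares_of_def by (elim exE conjE)
  then show ?thesis
    unfolding sum_of_squares_of_def using \<open>t \<ge> 0\<close>
    by (intro exI[of _ r] exI[of _ "\<lambda>j x. sqrt t * p j x"])
      (simp add: poly_fun_scale sum_distrib_left power_mult_distrib)
qed

lemma symmetric_tensors_add:
  assumes "A \<in> symmetric_tensors m n" and "B \<in> symmetric_tensors m n"
  shows "(\<lambda>i. A i + B i) \<in> symmetric_tensors m n"
proof (rule symmetric_tensorsI)
  fix "is" js assume "is \<in> multi_indices m n" "mset js = mset is"
  from symmetric_tensors_permute[OF assms(1) this] symmetric_tensors_permute[OF assms(2) this]
  show "A js + B js = A is + B is" by simp
qed (simp add: symmetric_tensors_eq_0[OF assms(1)] symmetric_tensors_eq_0[OF assms(2)])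

lemma symmetric_tensors_scale:
  assumes "A \<in> symmetric_tensors m n"
  shows "(\<lambda>i. t * A i) \<in> symmetric_tensors m n"
proof (rule symmetric_tensorsI)
  fix "is" js assume "is \<in> multi_indices m n" "mset js = mset is"
  from symmetric_tensors_permute[OF assms this] show "t * A js = t * A is" by simp
qed (simp add: symmetric_tensors_eq_0[OF assms])

lemma tensor_form_add:
  "tensor_form m n (\<lambda>i. A i + B i) x = tensor_form m n A x + tensor_form m n B x"
  by (simp add: tensor_form_def sum.distrib distrib_right)

lemma tensor_form_scale: "tensor_form m n (\<lambda>i. t * A i) x = t * tensor_form m n A x"
  by (simp add: tensor_form_def sum_distrib_left mult.assoc)

lemma SOS_add: "A \<in> SOS m n \<Longrightarrow> B \<in> SOS m n \<Longrightarrow> (\<lambda>i. A i + B i) \<in> SOS m n"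
  using sum_of_squares_of_add[of "poly_fun n" n "tensor_form m n A" "tensor_form m n B"]
  by (simp add: SOS_def symmetric_tensors_add tensor_form_add[abs_def])

lemma SOS_scale: "t \<ge> 0 \<Longrightarrow> A \<in> SOS m n \<Longrightarrow> (\<lambda>i. t * A i) \<in> SOS m n"
  using sum_of_squares_of_scale[of n "tensor_form m n A" t]
  by (simp add: SOS_def symmetric_tensors_scale tensor_form_scale[abs_def])

lemma zero_in_SOS: "(\<lambda>i. 0) \<in> SOS m n"
  by (auto simp: SOS_def tensor_form_def sum_of_squares_of_def intro!: symmetric_tensorsI exI[of _ 0])

lemma tensor_dual_cone_add:
  assumes "A \<in> dual_cone (symmetric_tensors m n) (tensor_inner m n) S"
    and "B \<in> dual_cone (symmetric_tensors m n) (tensor_inner m n) S"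
  shows "(\<lambda>i. A i + B i) \<in> dual_cone (symmetric_tensors m n) (tensor_inner m n) S"
  using assms
  by (auto simp: dual_cone_def symmetric_tensors_add tensor_inner_def sum.distrib distrib_right
      intro!: add_nonneg_nonneg)

lemma tensor_dual_cone_scale:
  assumes "t \<ge> 0" and "A \<in> dual_cone (symmetric_tensors m n) (tensor_inner m n) S"
  shows "(\<lambda>i. t * A i) \<in> dual_cone (symmetric_tensors m n) (tensor_inner m n) S"
  using assms
  by (auto simp: dual_cone_def symmetric_tensors_scale tensor_inner_def mult.assoc
      simp flip: sum_distrib_left)

text \<open>Every sum of squares needs at most as many squares as there are monomials, and their
  coefficients are bounded by finitely many values of the form, so the squares converge along
  a subsequence.\<close>

lemma SOS_closed:
  assumes "even m" and A: "\<And>k. A k \<in> SOS m n"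
    and lim: "\<And>is. is \<in> multi_indices m n \<Longrightarrow> (\<lambda>k. A k is) \<longlonglongrightarrow> B is"
    and B: "B \<in> symmetric_tensors m n"
  shows "B \<in> SOS m n"
proof -
  define J where "J = exponents n (m div 2)"
  have [simp]: "finite J" by (simp add: J_def)
  have form_lim: "(\<lambda>k. tensor_form m n (A k) x) \<longlonglongrightarrow> tensor_form m n B x" for x
    unfolding tensor_form_def by (intro tendsto_intros lim)
  have "\<forall>k. \<exists>w. \<forall>x\<in>carrier_vec n. tensor_form m n (A k) x =
      (\<Sum>i\<in>J. (\<Sum>e\<in>J. w i e * monom_val n e x)\<^sup>2)"
    using A unfolding SOS_iff[OF \<open>even m\<close>] homogeneous_sum_of_squares_iff J_def by blast
  from choice[OF this] obtain w where w: "\<And>k x. x \<in> carrier_vec n \<Longrightarrow> tensor_form m n (A k) x =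
      (\<Sum>i\<in>J. (\<Sum>e\<in>J. w k i e * monom_val n e x)\<^sup>2)" by blast
  have bounded: "Bseq (\<lambda>k. w k i e)" if ie: "i \<in> J" "e \<in> J" for i e
  proof -
    from coefficient_from_values[OF ie(2)[unfolded J_def]]
    obtain M :: nat and X l where *: "\<forall>s. X s \<in> carrier_vec n"
      "\<forall>c. c e = (\<Sum>s<M. l s * (\<Sum>e'\<in>J. c e' * monom_val n e' (X s)))"
      unfolding J_def by (elim exE conjE)
    have X: "X s \<in> carrier_vec n" for s using *(1) by (rule spec)
    have coeff: "c e = (\<Sum>s<M. l s * (\<Sum>e'\<in>J. c e' * monom_val n e' (X s)))" for c
      using *(2) by (rule spec)
    \<comment> \<open>By Cauchy-Schwarz in the extraction formula, \<open>F k\<close> bounds the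
      squared coefficient; it converges along with the tensors and is therefore bounded.\<close>
    define F where "F = (\<lambda>k. (\<Sum>s<M. (l s)\<^sup>2) * (\<Sum>s<M. tensor_form m n (A k) (X s)))"
    have le: "(w k i e)\<^sup>2 \<le> F k" for k
    proof -
      define L where "L = (\<lambda>i x. \<Sum>e'\<in>J. w k i e' * monom_val n e' x)"
      have "(w k i e)\<^sup>2 = (\<Sum>s<M. l s * L i (X s))\<^sup>2" unfolding L_def by (subst coeff) (rule refl)
      also have "\<dots> \<le> (\<Sum>s<M. (l s)\<^sup>2) * (\<Sum>s<M. (L i (X s))\<^sup>2)" by (rule Cauchy_Schwarz_ineq_sum)
      also have "\<dots> \<le> F k"
        unfolding F_def
      proof (intro mult_left_mono sum_mono)
        show "(L i (X s))\<^sup>2 \<le> tensor_form m n (A k) (X s)" for s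
          using ie member_le_sum[of i J "\<lambda>i. (L i (X s))\<^sup>2"] by (simp add: w[OF X] L_def)
      qed (simp add: sum_nonneg)
      finally show ?thesis .
    qed
    have "F \<longlonglongrightarrow> (\<Sum>s<M. (l s)\<^sup>2) * (\<Sum>s<M. tensor_form m n B (X s))"
      unfolding F_def by (intro tendsto_intros form_lim)
    then have "Bseq F" by (intro convergent_imp_Bseq convergentI)
    then obtain C where C: "\<And>k. norm (F k) \<le> C" by (auto simp: Bseq_def)
    show ?thesis
    proof (rule BseqI')
      show "norm (w k i e) \<le> C + 1" for k
        using abs_le_square_plus_one[of "w k i e"] le[of k] C[of k] by simp
    qed
  qed
  obtain r W where r: "strict_mono (r :: nat \<Rightarrow> nat)"
    and W: "\<And>p. p \<in> J \<times> J \<Longrightarrow> (\<lambda>k. w (r k) (fst p) (snd p)) \<longlonglongrightarrow> W p"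
  proof (rule finite_family_convergent_subseq[of "J \<times> J" "\<lambda>k p. w k (fst p) (snd p)"])
    show "Bseq (\<lambda>k. w k (fst p) (snd p))" if "p \<in> J \<times> J" for p
      using that by (intro bounded) auto
  qed auto
  have "tensor_form m n B x = (\<Sum>i\<in>J. (\<Sum>e\<in>J. W (i, e) * monom_val n e x)\<^sup>2)"
    if x: "x \<in> carrier_vec n" for x
  proof (rule LIMSEQ_unique)
    show "(\<lambda>k. tensor_form m n (A (r k)) x) \<longlonglongrightarrow> tensor_form m n B x"
      using LIMSEQ_subseq_LIMSEQ[OF form_lim r] by (simp add: o_def)
    have "(\<lambda>k. w (r k) i e) \<longlonglongrightarrow> W (i, e)" if "i \<in> J" "e \<in> J" for i e
      using W[of "(i, e)"] that by simp
    then show "(\<lambda>k. tensor_form m n (A (r k)) x) \<longlonglongrightarrow>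
        (\<Sum>i\<in>J. (\<Sum>e\<in>J. W (i, e) * monom_val n e x)\<^sup>2)"
      unfolding w[OF x] by (intro tendsto_intros)
  qed
  then show ?thesis
    unfolding SOS_iff[OF \<open>even m\<close>] homogeneous_sum_of_squares_iff J_def[symmetric] using B
    by (intro conjI exI[of _ "\<lambda>i e. W (i, e)"]) auto
qed

text \<open>The bipolar theorem for the closed cone \<open>SOS m n\<close>: a symmetric tensor
  outside it would be cut off by a separating tensor lying in the dual cone.\<close>

lemma SOS_bipolar:
  assumes "even m" and B: "B \<in> symmetric_tensors m n"
    and dual: "\<And>A. A \<in> dual_cone (symmetric_tensors m n) (tensor_inner m n) (SOS m n) \<Longrightarrow>
      tensor_inner m n A B \<ge> 0"
  shows "B \<in> SOS m n"
proof -
  have "SOS m n \<noteq> {}" using zero_in_SOS by blast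
  with finite_multi_indices show ?thesis
  proof (rule cone_separation[where y = B])
    show "(\<lambda>i. A i + C i) \<in> SOS m n" if "A \<in> SOS m n" "C \<in> SOS m n" for A C
      using that by (rule SOS_add)
    show "(\<lambda>i. t * A i) \<in> SOS m n" if "t \<ge> 0" "A \<in> SOS m n" for t A
      using that by (rule SOS_scale)
  next
    fix s
    assume "\<And>k. s k \<in> SOS m n" "\<And>is. is \<in> multi_indices m n \<Longrightarrow> (\<lambda>k. s k is) \<longlonglongrightarrow> B is"
    then show ?thesis using SOS_closed[OF \<open>even m\<close> _ _ B] by blast
  next
    fix s l
    assume s: "\<And>k :: nat. s k \<in> SOS m n"
      and l: "\<And>is. is \<in> multi_indices m n \<Longrightarrow> (\<lambda>k. s k is) \<longlonglongrightarrow> l is"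
      and nonneg: "\<And>C. C \<in> SOS m n \<Longrightarrow> 0 \<le> (\<Sum>is\<in>multi_indices m n. (l is - B is) * C is)"
      and neg: "(\<Sum>is\<in>multi_indices m n. (l is - B is) * B is) < 0"
    \<comment> \<open>Separation controls only the entries at multi-indices; the default 0 elsewhere
      makes the functional a tensor.\<close>
    define A where "A = (\<lambda>is. if is \<in> multi_indices m n then l is - B is else 0)"
    have inner: "tensor_inner m n A C = (\<Sum>is\<in>multi_indices m n. (l is - B is) * C is)" for C
      by (simp add: tensor_inner_def A_def)
    \<comment> \<open>\<open>l\<close> is known only as an entrywise limit of symmetric tensors on
      multi-indices; its symmetry follows from uniqueness of limits.\<close>
    have "A js = A is" if "is": "is \<in> multi_indices m n" and js: "mset js = mset is" for "is" js
    proof -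
      have js': "js \<in> multi_indices m n" using "is" js by (rule multi_indices_mset_cong)
      have "s k js = s k is" for k
        using s[of k] "is" js by (auto simp: SOS_def intro: symmetric_tensors_permute)
      then have "l js = l is"
        using l[OF js'] l[OF "is"] by (simp add: LIMSEQ_unique)
      moreover have "B js = B is" using B "is" js by (rule symmetric_tensors_permute)
      ultimately show ?thesis using "is" js' by (simp add: A_def)
    qed
    then have "A \<in> symmetric_tensors m n" by (intro symmetric_tensorsI) (simp_all add: A_def)
    then have "A \<in> dual_cone (symmetric_tensors m n) (tensor_inner m n) (SOS m n)"
      by (simp add: dual_cone_def inner nonneg)
    from dual[OF this] show ?thesis using neg by (simp add: inner)
  qed
qed

section \<open>Duality\<close>

text \<open>Finitely many coordinates determine the topology, so shrinking boxes suffice as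
  neighbourhoods. This matches closure with the limits produced by
  \<open>cone_separation\<close>.\<close>

lemma closure_of_vec_topology_sequential:
  assumes "S \<subseteq> carrier_vec N"
  shows "y \<in> vec_topology N closure_of S \<longleftrightarrow> y \<in> carrier_vec N \<and>
    (\<exists>s. (\<forall>k :: nat. s k \<in> S) \<and> (\<forall>i<N. (\<lambda>k. s k $ i) \<longlonglongrightarrow> y $ i))"
proof -
  define \<phi> where "\<phi> = (\<lambda>v i. if i < N then v $ i else 0 :: real)"
  show ?thesis
  proof (intro iffI conjI)
    assume y: "y \<in> vec_topology N closure_of S"
    then show "y \<in> carrier_vec N" by (simp add: in_closure_of topspace_vec_topology)
    have "\<exists>v\<in>S. \<forall>i<N. \<bar>v $ i - y $ i\<bar> < inverse (real (Suc k))" for k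
    proof -
      \<comment> \<open>An open box around \<open>y\<close> of half-width \<open>1 / (k + 1)\<close>
        that constrains only the first \<open>N\<close> coordinates.\<close>
      define W where "W = {f :: nat \<Rightarrow> real. \<forall>i\<in>{..<N}. f i \<in> ball (y $ i) (inverse (real (Suc k)))}"
      have "open W" 
        unfolding W_def
        using product_topology_basis'[of "{..<N}" "\<lambda>i. ball (y $ i) (inverse (real (Suc k)))" "\<lambda>i. i"]
        by simp
      then have "openin (Euclidean_space N) (W \<inter> topspace (Euclidean_space N))"
        unfolding Euclidean_space_def euclidean_product_topology topspace_subtopology openin_subtopology
        by (intro exI[of _ W]) simp
      then have T: "openin (vec_topology N) (\<phi> -` (W \<inter> topspace (Euclidean_space N)) \<inter> carrier_vec N)"
        unfolding vec_topology_def openin_pullback_topology \<phi>_def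
        by (intro exI[of _ "W \<inter> topspace (Euclidean_space N)"]) simp
      have "y \<in> \<phi> -` (W \<inter> topspace (Euclidean_space N)) \<inter> carrier_vec N"
        using \<open>y \<in> carrier_vec N\<close> by (simp add: \<phi>_def W_def topspace_Euclidean_space)
      from y[unfolded in_closure_of, THEN conjunct2, THEN spec, THEN mp, OF conjI[OF this T]]
      obtain v where v: "v \<in> S" "\<phi> v \<in> W" by auto
      from v(2) have "\<forall>i<N. \<bar>v $ i - y $ i\<bar> < inverse (real (Suc k))"
        by (simp add: W_def \<phi>_def dist_real_def abs_minus_commute)
      with v(1) show ?thesis by (rule bexI[rotated])
    qed
    then have "\<forall>k. \<exists>v. v \<in> S \<and> (\<forall>i<N. \<bar>v $ i - y $ i\<bar> < inverse (real (Suc k)))" by blast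
    from choice[OF this] obtain s where s: "\<And>k. s k \<in> S"
      "\<And>k. \<forall>i<N. \<bar>s k $ i - y $ i\<bar> < inverse (real (Suc k))" by blast
    have "(\<lambda>k. s k $ i) \<longlonglongrightarrow> y $ i" if "i < N" for i
    proof (rule LIM_zero_cancel, rule Lim_null_comparison[OF _ LIMSEQ_inverse_real_of_nat])
      show "\<forall>\<^sub>F k in sequentially. norm (s k $ i - y $ i) \<le> inverse (real (Suc k))"
        using s(2) that by (intro always_eventually allI) (simp add: less_imp_le)
    qed
    then show "\<exists>s. (\<forall>k :: nat. s k \<in> S) \<and> (\<forall>i<N. (\<lambda>k. s k $ i) \<longlonglongrightarrow> y $ i)"
      using s(1) by (intro exI[of _ s]) simp
  next
    assume "y \<in> carrier_vec N \<and> (\<exists>s. (\<forall>k :: nat. s k \<in> S) \<and> (\<forall>i<N. (\<lambda>k. s k $ i) \<longlonglongrightarrow> y $ i))"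
    then obtain s where y: "y \<in> carrier_vec N" and s: "\<forall>k :: nat. s k \<in> S"
      and lim: "\<forall>i<N. (\<lambda>k. s k $ i) \<longlonglongrightarrow> y $ i" by (elim exE conjE)
    \<comment> \<open>The function space carries the product topology, so convergence is checked by
      coordinates; those from \<open>N\<close> on are constantly 0.\<close>
    have "limitin (product_topology (\<lambda>i. euclideanreal) UNIV) (\<lambda>k. \<phi> (s k)) (\<phi> y) sequentially"
      unfolding limitin_componentwise using lim by (auto simp: \<phi>_def)
    then have "limitin euclidean (\<lambda>k. \<phi> (s k)) (\<phi> y) sequentially"
      unfolding euclidean_product_topology .
    then have conv: "(\<lambda>k. \<phi> (s k)) \<longlonglongrightarrow> \<phi> y" by simp
    show "y \<in> vec_topology N closure_of S"
      unfolding in_closure_of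
    proof (intro conjI allI impI)
      show "y \<in> topspace (vec_topology N)" using y by (simp add: topspace_vec_topology)
      fix T assume T: "y \<in> T \<and> openin (vec_topology N) T"
      then have "\<exists>U. openin (Euclidean_space N) U \<and> T = \<phi> -` U \<inter> carrier_vec N"
        unfolding vec_topology_def openin_pullback_topology \<phi>_def by (rule conjunct2)
      then obtain U where U: "openin (Euclidean_space N) U" "T = \<phi> -` U \<inter> carrier_vec N"
        by (elim exE conjE)
      from U(1) have "\<exists>W. openin euclidean W \<and> U = W \<inter> {x. \<forall>i\<ge>N. x i = 0}"
        unfolding Euclidean_space_def euclidean_product_topology openin_subtopology .
      then obtain W where "openin euclidean W" and W: "U = W \<inter> {x. \<forall>i\<ge>N. x i = 0}"
        by (elim exE conjE)
      then have "open W" by (simp only: iffD2[OF open_openin])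
      have "\<phi> y \<in> W" using T U(2) W by auto
      with conv \<open>open W\<close> have "\<forall>\<^sub>F k in sequentially. \<phi> (s k) \<in> W" by (rule topological_tendstoD)
      then obtain k where "\<phi> (s k) \<in> W" by (auto dest: eventually_happens)
      moreover have "s k \<in> carrier_vec N" using s assms by blast
      ultimately have "s k \<in> T" unfolding U(2) W by (auto simp: \<phi>_def)
      then show "\<exists>v. v \<in> S \<and> v \<in> T" using s by (intro exI[of _ "s k"]) simp
    qed
  qed
qed

lemma scalar_prod_tensor_form:
  assumes "\<alpha> \<in> carrier_vec ((n - 1) * m + 1)"
  shows "Matrix.vec ((n - 1) * m + 1) (\<lambda>k. tensor_form m n A (vandermonde_vec n (u k))) \<bullet> \<alpha> =
    tensor_inner m n A (vandermonde_tensor m n u \<alpha>)"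
  using assms
  by (auto simp: tensor_inner_vandermonde_tensor scalar_prod_def lessThan_atLeast0 mult.commute
      intro!: sum.cong)

lemma SG_dual:
  fixes m n :: nat and u :: "nat \<Rightarrow> real"
  assumes "even m"
  defines "N \<equiv> (n - 1) * m + 1"
  shows "dual_cone (carrier_vec N) scalar_prod (SG m n u) =
      vec_topology N closure_of
        {Matrix.vec N (\<lambda>k. tensor_form m n A (vandermonde_vec n (u k))) | A.
           A \<in> dual_cone (symmetric_tensors m n) (tensor_inner m n) (SOS m n)}"
    (is "?L = _ closure_of ?T")
proof -
  define K where "K = dual_cone (symmetric_tensors m n) (tensor_inner m n) (SOS m n)"
  have T_carrier: "?T \<subseteq> carrier_vec N" by auto
  show ?thesis
  proof (intro equalityI subsetI)
    fix y assume y: "y \<in> vec_topology N closure_of ?T"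
    then obtain s where yN: "y \<in> carrier_vec N" and s: "\<And>k :: nat. s k \<in> ?T"
      and lim: "\<And>i. i < N \<Longrightarrow> (\<lambda>k. s k $ i) \<longlonglongrightarrow> y $ i"
      unfolding closure_of_vec_topology_sequential[OF T_carrier] by blast
    \<comment> \<open>Adjointness gives nonnegativity for the approximants, and it survives the
      limit.\<close>
    have "y \<bullet> \<alpha> \<ge> 0" if \<alpha>: "\<alpha> \<in> SG m n u" for \<alpha>
    proof (rule LIMSEQ_le_const)
      have \<alpha>': "\<alpha> \<in> carrier_vec N" "vandermonde_tensor m n u \<alpha> \<in> SOS m n"
        using \<alpha> by (auto simp: SG_iff N_def)
      have "s k \<bullet> \<alpha> \<ge> 0" for k
      proof -
        from s[of k] obtain A where "A \<in> K"
          "s k = Matrix.vec N (\<lambda>k. tensor_form m n A (vandermonde_vec n (u k)))"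
          unfolding K_def by blast
        then show ?thesis
          using \<alpha>' scalar_prod_tensor_form[of \<alpha> n m A u] unfolding N_def K_def
          by (simp only: dual_cone_def mem_Collect_eq)
      qed
      then show "\<exists>k0. \<forall>k\<ge>k0. 0 \<le> s k \<bullet> \<alpha>" by blast
      show "(\<lambda>k. s k \<bullet> \<alpha>) \<longlonglongrightarrow> y \<bullet> \<alpha>"
        using \<alpha>'(1) unfolding scalar_prod_def by (intro tendsto_intros lim) auto
    qed
    then show "y \<in> ?L" using yN by (simp add: dual_cone_def)
  next
    fix y assume "y \<in> ?L"
    then have yN: "y \<in> carrier_vec N" and y: "\<And>\<alpha>. \<alpha> \<in> SG m n u \<Longrightarrow> y \<bullet> \<alpha> \<ge> 0"
      by (auto simp: dual_cone_def)
    \<comment> \<open>The cone of evaluations, kept as functions on all of \<open>nat\<close>;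
      separation compares only the coordinates below \<open>N\<close>.\<close>
    define M where "M = (\<lambda>A i. tensor_form m n A (vandermonde_vec n (u i))) ` K"
    have "(\<lambda>i. 0) \<in> K" by (auto simp: K_def dual_cone_def tensor_inner_def intro!: symmetric_tensorsI)
    then have "M \<noteq> {}" by (auto simp: M_def)
    with finite_lessThan[of N] show "y \<in> vec_topology N closure_of ?T"
    proof (rule cone_separation[where y = "\<lambda>i. y $ i"])
      fix a b assume "a \<in> M" "b \<in> M"
      then show "(\<lambda>i. a i + b i) \<in> M"
        unfolding M_def K_def by (force simp flip: tensor_form_add intro: tensor_dual_cone_add)
    next
      fix t :: real and a assume "t \<ge> 0" "a \<in> M"
      then show "(\<lambda>i. t * a i) \<in> M"
        unfolding M_def K_def by (force simp flip: tensor_form_scale intro: tensor_dual_cone_scale)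
    next
      fix s
      assume s: "\<And>k. s k \<in> M" and lim: "\<And>i. i \<in> {..<N} \<Longrightarrow> (\<lambda>k. s k i) \<longlonglongrightarrow> y $ i"
      have "Matrix.vec N (s k) \<in> ?T" for k
      proof -
        from s[of k] obtain A where "A \<in> K" "s k = (\<lambda>i. tensor_form m n A (vandermonde_vec n (u i)))"
          unfolding M_def by blast
        then show ?thesis unfolding K_def by auto
      qed
      then show ?thesis
        unfolding closure_of_vec_topology_sequential[OF T_carrier]
        using lim yN by (intro conjI exI[of _ "\<lambda>k. Matrix.vec N (s k)"]) auto
    next
      fix s l
      assume nonneg: "\<And>c. c \<in> M \<Longrightarrow> 0 \<le> (\<Sum>i<N. (l i - y $ i) * c i)"
        and neg: "(\<Sum>i<N. (l i - y $ i) * y $ i) < 0"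
      \<comment> \<open>The separating vector pairs nonnegatively with all evaluations, so by
        adjointness and bipolarity its tensor is a sum of squares. Then \<open>y\<close> must pair
        nonnegatively with it, against \<open>neg\<close>.\<close>
      define \<beta> where "\<beta> = Matrix.vec N (\<lambda>i. l i - y $ i)"
      have \<beta>: "\<beta> \<in> carrier_vec N" by (simp add: \<beta>_def)
      have "vandermonde_tensor m n u \<beta> \<in> SOS m n"
        using \<open>even m\<close> vandermonde_tensor_symmetric
      proof (rule SOS_bipolar)
        fix A assume "A \<in> dual_cone (symmetric_tensors m n) (tensor_inner m n) (SOS m n)"
        then have "(\<lambda>i. tensor_form m n A (vandermonde_vec n (u i))) \<in> M"
          by (simp add: M_def K_def)
        from nonneg[OF this] show "0 \<le> tensor_inner m n A (vandermonde_tensor m n u \<beta>)"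
          unfolding tensor_inner_vandermonde_tensor N_def[symmetric] by (simp add: \<beta>_def)
      qed
      then have "\<beta> \<in> SG m n u" using \<beta> by (simp add: SG_iff N_def)
      from y[OF this] have "0 \<le> (\<Sum>i<N. (l i - y $ i) * y $ i)"
        by (simp add: \<beta>_def scalar_prod_def lessThan_atLeast0 mult.commute)
      with neg show ?thesis by simp
    qed
  qed
qed

theorem theorem5:
  fixes m n :: nat and u :: "nat \<Rightarrow> real"
  assumes "m > 0" and "even m" and "n > 0"
    and "inj_on u {0..(n - 1) * m}"
  shows "let N = (n - 1) * m + 1; UT = transpose_mat (vandermonde_mat N u) in
    invertible_mat UT \<and>
    dual_cone (carrier_vec N) scalar_prod (HSOS m n) =
      {the (mat_inverse UT) *\<^sub>v \<alpha> | \<alpha>. \<alpha> \<in> dual_cone (carrier_vec N) scalar_prod (SG m n u)} \<and>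
    dual_cone (carrier_vec N) scalar_prod (SG m n u) =
      vec_topology N closure_of
        {Matrix.vec N (\<lambda>k. tensor_form m n A (vandermonde_vec n (u k))) | A.
           A \<in> dual_cone (symmetric_tensors m n) (tensor_inner m n) (SOS m n)}"
proof -
  define N where "N = (n - 1) * m + 1"
  define U where "U = vandermonde_mat N u"
  have U: "U \<in> carrier_mat N N" and UT: "transpose_mat U \<in> carrier_mat N N"
    by (simp_all add: U_def)
  have "inj_on u {..<N}"
    using assms(4) by (simp add: N_def lessThan_Suc_atMost atLeast0AtMost)
  then have "det (transpose_mat U) \<noteq> 0" unfolding U_def by (rule det_transpose_vandermonde)
  then have "transpose_mat U \<in> Units (ring_mat TYPE(real) N ())"
    using UT by (intro det_non_zero_imp_unit)
  \<comment> \<open>\<open>mat_inverse\<close> returns an option; invertibility excludes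
    \<open>None\<close>, so \<open>the\<close> in the claim yields the actual inverse.\<close>
  then obtain W where inv: "mat_inverse (transpose_mat U) = Some W"
    using mat_inverse(1)[OF UT, where b = "()"] by (cases "mat_inverse (transpose_mat U)") auto
  then have W: "transpose_mat U * W = 1\<^sub>m N" "W * transpose_mat U = 1\<^sub>m N" "W \<in> carrier_mat N N"
    using mat_inverse(2)[OF UT] by blast+
  have "invertible_mat (transpose_mat U)"
    using W UT unfolding invertible_mat_def inverts_mat_def square_mat.simps
    by (intro conjI exI[of _ W]) auto
  moreover have "dual_cone (carrier_vec N) scalar_prod (HSOS m n) =
      {W *\<^sub>v \<alpha> | \<alpha>. \<alpha> \<in> dual_cone (carrier_vec N) scalar_prod (SG m n u)}"
  proof -
    have adj: "(transpose_mat U *\<^sub>v y) \<bullet> \<alpha> = y \<bullet> (U *\<^sub>v \<alpha>)"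
      if "y \<in> carrier_vec N" "\<alpha> \<in> carrier_vec N" for y \<alpha>
      using transpose_vec_mult_scalar[OF U that(2,1)] .
    have HSOS: "U *\<^sub>v \<alpha> \<in> HSOS m n \<longleftrightarrow> \<alpha> \<in> SG m n u" if "\<alpha> \<in> carrier_vec N" for \<alpha>
      using vandermonde_mat_HSOS_iff[of m n \<alpha> u] assms(2,3) that by (simp add: U_def N_def)
    have WT: "transpose_mat W \<in> carrier_mat N N" using W(3) by simp
    have "U * transpose_mat W = 1\<^sub>m N"
      using transpose_mult[OF W(3) UT] W(2) by simp
    \<comment> \<open>Since \<open>U\<close> is onto, every member of \<open>HSOS m n\<close> is the
      image of a vector, which then lies in \<open>SG m n u\<close>.\<close>
    then have surj: "U *\<^sub>v (transpose_mat W *\<^sub>v v) = v" if "v \<in> carrier_vec N" for v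
      using that assoc_mult_mat_vec[OF U WT that] by simp
    \<comment> \<open>Moving \<open>U\<close> across the inner product turns a test of
      \<open>y\<close> against the image of \<open>SG m n u\<close> under \<open>U\<close> into a
      test of the transpose applied to \<open>y\<close> against \<open>SG m n u\<close>
      itself.\<close>
    have dual_iff: "y \<in> dual_cone (carrier_vec N) scalar_prod (HSOS m n) \<longleftrightarrow>
        transpose_mat U *\<^sub>v y \<in> dual_cone (carrier_vec N) scalar_prod (SG m n u)"
      if y: "y \<in> carrier_vec N" for y
    proof -
      have "(\<forall>v\<in>HSOS m n. y \<bullet> v \<ge> 0) \<longleftrightarrow> (\<forall>\<alpha>\<in>SG m n u. y \<bullet> (U *\<^sub>v \<alpha>) \<ge> 0)"
      proof (intro iffI ballI)
        fix \<alpha> assume "\<forall>v\<in>HSOS m n. y \<bullet> v \<ge> 0" and \<alpha>: "\<alpha> \<in> SG m n u"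
        moreover have "\<alpha> \<in> carrier_vec N" using \<alpha> by (simp add: SG_iff N_def)
        ultimately show "y \<bullet> (U *\<^sub>v \<alpha>) \<ge> 0" using HSOS by blast
      next
        fix v assume SG: "\<forall>\<alpha>\<in>SG m n u. y \<bullet> (U *\<^sub>v \<alpha>) \<ge> 0" and v: "v \<in> HSOS m n"
        then have vN: "v \<in> carrier_vec N" by (simp add: HSOS_def N_def)
        moreover have "transpose_mat W *\<^sub>v v \<in> carrier_vec N" using WT vN by simp
        ultimately have "transpose_mat W *\<^sub>v v \<in> SG m n u" using HSOS v surj by metis
        then show "y \<bullet> v \<ge> 0" using SG surj[OF vN] by metis
      qed
      moreover have "\<alpha> \<in> SG m n u \<Longrightarrow> (transpose_mat U *\<^sub>v y) \<bullet> \<alpha> = y \<bullet> (U *\<^sub>v \<alpha>)" for \<alpha>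
        using adj[OF y] by (simp add: SG_iff N_def)
      moreover have "transpose_mat U *\<^sub>v y \<in> carrier_vec N" using UT y by simp
      ultimately show ?thesis using y by (simp add: dual_cone_def)
    qed
    show ?thesis
    proof (intro equalityI subsetI)
      fix y assume *: "y \<in> dual_cone (carrier_vec N) scalar_prod (HSOS m n)"
      then have y: "y \<in> carrier_vec N" by (simp add: dual_cone_def)
      then have "W *\<^sub>v (transpose_mat U *\<^sub>v y) = y"
        using assoc_mult_mat_vec[OF W(3) UT y] W(2) by simp
      then show "y \<in> {W *\<^sub>v \<alpha> | \<alpha>. \<alpha> \<in> dual_cone (carrier_vec N) scalar_prod (SG m n u)}"
        using * dual_iff[OF y] by (auto intro!: exI[of _ "transpose_mat U *\<^sub>v y"])
    next
      fix y assume "y \<in> {W *\<^sub>v \<alpha> | \<alpha>. \<alpha> \<in> dual_cone (carrier_vec N) scalar_prod (SG m n u)}"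
      then obtain \<alpha> where \<alpha>: "y = W *\<^sub>v \<alpha>" "\<alpha> \<in> dual_cone (carrier_vec N) scalar_prod (SG m n u)"
        by blast
      have \<alpha>N: "\<alpha> \<in> carrier_vec N" using \<alpha>(2) by (simp add: dual_cone_def)
      then have "transpose_mat U *\<^sub>v y = \<alpha>"
        using assoc_mult_mat_vec[OF UT W(3) \<alpha>N] W(1) by (simp add: \<alpha>(1))
      moreover have "y \<in> carrier_vec N" using W(3) \<alpha>N by (simp add: \<alpha>(1))
      ultimately show "y \<in> dual_cone (carrier_vec N) scalar_prod (HSOS m n)"
        using dual_iff \<alpha>(2) by simp
    qed
  qed
  ultimately show ?thesis
    using SG_dual[OF assms(2), of n u] inv by (simp add: Let_def N_def U_def)
qed

end
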